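(* Let $A$ be a finite-dimensional $\mathbb{C}$-algebra (not assumed commutative, associative or unital). Let $H$ be any finite subgroup of the automorphism group $\mathrm{Aut}(A)$ and let $(\mathrm{Irr}(H),* )$ be its representation fusion law. Let $\{H_i\mid i\in\mathcal{I}\}$ be a set of (some or all) conjugates of $H$ in $\mathrm{Aut}(A)$ indexed by some set $\mathcal{I}$. Then: (i) The $H$-isotypic decomposition $A=\bigoplus_{\chi\in\mathrm{Irr}(H)}A_\chi$ of $A$ is an $(\mathrm{Irr}(H),* )$-decomposition. (ii) If $A$ is multiplicity-free (as a $\mathbb{C}H$-module), then any non-zero element $a\in A_1$ is an axis for this decomposition, where $A_1$ is the component of the trivial character. (iii) For each $i\in\mathcal{I}$, let $A=\bigoplus_{\chi\in\mathrm{Irr}(H)}A^i_\chi$ be the $H_i$-isotypic decomposition of $A$. Let $\Omega=((A^i_\chi)_{\chi\in\mathrm{Irr}(H)}\mid i\in\mathcal{I})$. Then $(A,\mathcal{I},\Omega)$ is an $(\mathrm{Irr}(H),* )$-decomposition algebra. (iv) Suppose that $A$ is multiplicity-free (as a $\mathbb{C}H$-module) and that for each $i\in\mathcal{I}$, $a_i$ is a non-zero element of $A^i_1$. Then $(A,\mathcal{I},\Omega,\alpha)$ is an axial decomposition algebra, where $\alpha\colon\mathcal{I}\to A\colon i\mapsto a_i$.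
   Context: Fusion laws. A fusion law is a pair $(X,* )$ with $X$ a set and $*\colon X\times X\to2^X$; $e\in X$ is a unit if $e*x\subseteq\{x\}$ and $x*e\subseteq\{x\}$ for all $x\in X$. For a finite group $H$, the representation fusion law is $(\mathrm{Irr}(H),* )$, where $\mathrm{Irr}(H)$ is the set of irreducible complex characters and $\chi\in\chi_1*\chi_2$ iff $\chi$ is a constituent of $\chi_1\otimes\chi_2$; the trivial character, denoted $1$, is a unit and is taken as the distinguished unit. Isotypic decomposition. If $V_1\oplus\dots\oplus V_n$ is a decomposition of a $\mathbb{C}H$-module $A$ into irreducible submodules with characters $\chi_1,\dots,\chi_n$, then $A_\chi:=\bigoplus_{\chi_i=\chi}V_i$ and $A=\bigoplus_{\chi\in\mathrm{Irr}(H)}A_\chi$ is the $H$-isotypic decomposition. $A$ is multiplicity-free if $\chi_i\ne\chi_j$ for all $i\ne j$. For each $i\in\mathcal{I}$ fix $g_i\in\mathrm{Aut}(A)$ with $H_i=g_iHg_i^{-1}$ and use conjugation by $g_i$ to identify $\mathrm{Irr}(H_i)$ with $\mathrm{Irr}(H)$; with this labelling $A^i_\chi=g_i(A_\chi)$. Decompositions. For a fusion law $\Phi=(X,* )$, a $\Phi$-decomposition of an algebra $A$ is a vector space decomposition $A=\bigoplus_{x\in X}A_x$ with $A_xA_y\subseteq\bigoplus_{z\in x*y}A_z$ for all $x,y\in X$. A $\Phi$-decomposition algebra is a triple $(A,\mathcal{I},\Omega)$ with $\Omega=((A^i_x)_{x\in X}\mid i\in\mathcal{I})$ a tuple of $\Phi$-decompositions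 of $A$. Given a distinguished unit $e\in X$, a (left) axis for a decomposition $(A_x)_{x\in X}$ is a non-zero $a\in A_e$ such that for each $x\in X$ there is a scalar $\lambda_x\in\mathbb{C}$ with $a\cdot b=\lambda_xb$ for all $b\in A_x$. $(A,\mathcal{I},\Omega,\alpha)$, with $\alpha\colon\mathcal{I}\to A$, $i\mapsto a_i$, is a (left-)axial decomposition algebra if there are scalars $\lambda_x\in\mathbb{C}$ ($x\in X$), independent of $i$, such that for all $i\in\mathcal{I}$, $a_i$ is a non-zero element of $A^i_e$ and $a_i\cdot b=\lambda_xb$ for all $x\in X$, $b\in A^i_x$.
   Formalization: Part (iv) is false for arbitrary non-zero a_i (A=ℂ, H=1, a_1=1, a_2=2: scalars differ). Proved instead: each a_i is an axis; after rescaling by non-zero scalars the a_i give an axial decomposition algebra; and α itself does if a_i=g_i(a) for one common a. *)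

theory Defs
  imports "HOL-Algebra.Coset" "Jordan_Normal_Form.Matrix"
begin

section \<open>Fusion laws\<close>

type_synonym 'x fusion_law = "'x set \<times> ('x \<Rightarrow> 'x \<Rightarrow> 'x set)"

definition is_fusion_law :: "'x fusion_law \<Rightarrow> bool" where
  "is_fusion_law \<Phi> \<longleftrightarrow> (\<forall>x\<in>fst \<Phi>. \<forall>y\<in>fst \<Phi>. snd \<Phi> x y \<subseteq> fst \<Phi>)"

definition fusion_unit :: "'x fusion_law \<Rightarrow> 'x \<Rightarrow> bool" where
  "fusion_unit \<Phi> e \<longleftrightarrow> e \<in> fst \<Phi> \<and>
     (\<forall>x\<in>fst \<Phi>. snd \<Phi> e x \<subseteq> {x} \<and> snd \<Phi> x e \<subseteq> {x})"


section \<open>Irreducible characters and the representation fusion law\<close>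

definition matrix_rep :: "('g, 'm) monoid_scheme \<Rightarrow> nat \<Rightarrow> ('g \<Rightarrow> complex mat) \<Rightarrow> bool" where
  "matrix_rep G n \<rho> \<longleftrightarrow>
     (\<forall>g\<in>carrier G. \<rho> g \<in> carrier_mat n n) \<and> \<rho> \<one>\<^bsub>G\<^esub> = 1\<^sub>m n \<and>
     (\<forall>g\<in>carrier G. \<forall>h\<in>carrier G. \<rho> (g \<otimes>\<^bsub>G\<^esub> h) = \<rho> g * \<rho> h)"

definition vec_subspace :: "nat \<Rightarrow> complex vec set \<Rightarrow> bool" where
  "vec_subspace n U \<longleftrightarrow> U \<subseteq> carrier_vec n \<and> 0\<^sub>v n \<in> U \<and>
     (\<forall>u\<in>U. \<forall>v\<in>U. u + v \<in> U) \<and> (\<forall>c. \<forall>u\<in>U. c \<cdot>\<^sub>v u \<in> U)"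

definition irreducible_rep :: "('g, 'm) monoid_scheme \<Rightarrow> nat \<Rightarrow> ('g \<Rightarrow> complex mat) \<Rightarrow> bool" where
  "irreducible_rep G n \<rho> \<longleftrightarrow> matrix_rep G n \<rho> \<and> n \<noteq> 0 \<and>
     (\<forall>U. vec_subspace n U \<and> (\<forall>g\<in>carrier G. \<forall>u\<in>U. \<rho> g *\<^sub>v u \<in> U)
          \<longrightarrow> U = {0\<^sub>v n} \<or> U = carrier_vec n)"

text \<open>Characters are taken to be \<^const>\<open>undefined\<close> outside the group, so that they can be
  compared by equality.\<close>

definition rep_char :: "('g, 'm) monoid_scheme \<Rightarrow> nat \<Rightarrow> ('g \<Rightarrow> complex mat) \<Rightarrow> 'g \<Rightarrow> complex" where
  "rep_char G n \<rho> = (\<lambda>g\<in>carrier G. \<Sum>i<n. \<rho> g $$ (i, i))"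

definition Irr :: "('g, 'm) monoid_scheme \<Rightarrow> ('g \<Rightarrow> complex) set" where
  "Irr G = {\<chi>. \<exists>n \<rho>. irreducible_rep G n \<rho> \<and> \<chi> = rep_char G n \<rho>}"

definition trivial_char :: "('g, 'm) monoid_scheme \<Rightarrow> 'g \<Rightarrow> complex" where
  "trivial_char G = (\<lambda>g\<in>carrier G. 1)"

definition kronecker :: "complex mat \<Rightarrow> complex mat \<Rightarrow> complex mat" where
  "kronecker A B = mat (dim_row A * dim_row B) (dim_col A * dim_col B)
     (\<lambda>(i, j). A $$ (i div dim_row B, j div dim_col B) * B $$ (i mod dim_row B, j mod dim_col B))"

text \<open>A constituent of a representation \<open>\<sigma>\<close> is the character of an irreducible submodule;
  the submodule is given as the image of an injective intertwining matrix.\<close>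

definition constituent ::
  "('g, 'm) monoid_scheme \<Rightarrow> nat \<Rightarrow> ('g \<Rightarrow> complex mat) \<Rightarrow> ('g \<Rightarrow> complex) \<Rightarrow> bool" where
  "constituent G m \<sigma> \<chi> \<longleftrightarrow>
     (\<exists>d \<rho> T. irreducible_rep G d \<rho> \<and> \<chi> = rep_char G d \<rho> \<and> T \<in> carrier_mat m d \<and>
        (\<forall>v\<in>carrier_vec d. T *\<^sub>v v = 0\<^sub>v m \<longrightarrow> v = 0\<^sub>v d) \<and>
        (\<forall>g\<in>carrier G. T * \<rho> g = \<sigma> g * T))"

definition rep_fusion_law :: "('g, 'm) monoid_scheme \<Rightarrow> ('g \<Rightarrow> complex) fusion_law" where
  "rep_fusion_law G = (Irr G, \<lambda>\<chi>1 \<chi>2. {\<chi>.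
     \<exists>n1 \<rho>1 n2 \<rho>2. irreducible_rep G n1 \<rho>1 \<and> \<chi>1 = rep_char G n1 \<rho>1 \<and>
       irreducible_rep G n2 \<rho>2 \<and> \<chi>2 = rep_char G n2 \<rho>2 \<and>
       constituent G (n1 * n2) (\<lambda>g. kronecker (\<rho>1 g) (\<rho>2 g)) \<chi>})"


section \<open>Conjugate subgroups\<close>

definition conj_subgroup :: "('g, 'm) monoid_scheme \<Rightarrow> 'g \<Rightarrow> 'g set \<Rightarrow> 'g set" where
  "conj_subgroup G x H = (\<lambda>h. x \<otimes>\<^bsub>G\<^esub> h \<otimes>\<^bsub>G\<^esub> inv\<^bsub>G\<^esub> x) ` H"

text \<open>The identification of the characters of \<open>H\<close> with those of \<open>x H x\<^sup>-\<^sup>1\<close>.\<close>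

definition conj_char ::
  "('g, 'm) monoid_scheme \<Rightarrow> 'g \<Rightarrow> 'g set \<Rightarrow> ('g \<Rightarrow> complex) \<Rightarrow> 'g \<Rightarrow> complex" where
  "conj_char G x H \<chi> = (\<lambda>k\<in>conj_subgroup G x H. \<chi> (inv\<^bsub>G\<^esub> x \<otimes>\<^bsub>G\<^esub> k \<otimes>\<^bsub>G\<^esub> x))"


section \<open>Finite-dimensional complex algebras and their decompositions\<close>

locale fd_algebra = vector_space scale
  for scale :: "complex \<Rightarrow> 'a::ab_group_add \<Rightarrow> 'a" (infixr \<open>*s\<close> 75) +
  fixes mul :: "'a \<Rightarrow> 'a \<Rightarrow> 'a" (infixl \<open>\<cdot>\<close> 70)
  assumes linear_left: "\<And>b. Vector_Spaces.linear scale scale (\<lambda>a. a \<cdot> b)"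
    and linear_right: "\<And>a. Vector_Spaces.linear scale scale (\<lambda>b. a \<cdot> b)"
    and finite_dim: "\<exists>B. finite B \<and> span B = UNIV"
begin

definition Aut :: "('a \<Rightarrow> 'a) monoid" where
  "Aut = \<lparr>carrier = {f. Vector_Spaces.linear scale scale f \<and> bij f \<and>
                        (\<forall>a b. f (a \<cdot> b) = f a \<cdot> f b)},
          monoid.mult = (\<circ>), one = id\<rparr>"

text \<open>The sum of the subspaces \<open>D x\<close>, \<open>x \<in> X\<close>.\<close>

definition sum_space :: "'x set \<Rightarrow> ('x \<Rightarrow> 'a set) \<Rightarrow> 'a set" where
  "sum_space X D = span (\<Union>x\<in>X. D x)"

text \<open>The algebra is the internal direct sum of the \<open>D x\<close>, \<open>x \<in> X\<close>. The index set need not be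
  finite, hence the finitely supported families.\<close>

definition direct_sum_decomposition :: "'x set \<Rightarrow> ('x \<Rightarrow> 'a set) \<Rightarrow> bool" where
  "direct_sum_decomposition X D \<longleftrightarrow> (\<forall>x\<in>X. subspace (D x)) \<and>
     (\<forall>v. \<exists>!f. (\<forall>x. f x \<in> (if x \<in> X then D x else {0})) \<and>
                finite {x. f x \<noteq> 0} \<and> v = (\<Sum>x | f x \<noteq> 0. f x))"

subsection \<open>Isotypic decompositions\<close>

definition invariant_subspace :: "('a \<Rightarrow> 'a) set \<Rightarrow> 'a set \<Rightarrow> bool" where
  "invariant_subspace H V \<longleftrightarrow> subspace V \<and> (\<forall>h\<in>H. h ` V \<subseteq> V)"

definition irreducible_submodule :: "('a \<Rightarrow> 'a) set \<Rightarrow> 'a set \<Rightarrow> bool" where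
  "irreducible_submodule H V \<longleftrightarrow> invariant_subspace H V \<and> V \<noteq> {0} \<and>
     (\<forall>W. invariant_subspace H W \<and> W \<subseteq> V \<longrightarrow> W = {0} \<or> W = V)"

text \<open>The trace of \<open>f\<close> restricted to the \<open>f\<close>-invariant subspace \<open>V\<close>; the value does not depend on
  the chosen basis.\<close>

definition trace_on :: "'a set \<Rightarrow> ('a \<Rightarrow> 'a) \<Rightarrow> complex" where
  "trace_on V f = (let B = (SOME B. independent B \<and> span B = V)
                   in \<Sum>b\<in>B. representation B (f b) b)"

definition submodule_char :: "('a \<Rightarrow> 'a) set \<Rightarrow> 'a set \<Rightarrow> ('a \<Rightarrow> 'a) \<Rightarrow> complex" where
  "submodule_char H V = (\<lambda>h\<in>H. trace_on V h)"

definition irreducible_decomposition :: "('a \<Rightarrow> 'a) set \<Rightarrow> nat \<Rightarrow> (nat \<Rightarrow> 'a set) \<Rightarrow> bool" where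
  "irreducible_decomposition H n V \<longleftrightarrow>
     direct_sum_decomposition {..<n} V \<and> (\<forall>i<n. irreducible_submodule H (V i))"

definition is_isotypic ::
  "('a \<Rightarrow> 'a) set \<Rightarrow> ((('a \<Rightarrow> 'a) \<Rightarrow> complex) \<Rightarrow> 'a set) \<Rightarrow> bool" where
  "is_isotypic H D \<longleftrightarrow> (\<exists>n V. irreducible_decomposition H n V \<and>
     (\<forall>\<chi>. D \<chi> = sum_space {i. i < n \<and> submodule_char H (V i) = \<chi>} V))"

text \<open>For a finite group \<open>H\<close> of automorphisms the description is unique: an irreducible
  decomposition exists by Maschke's theorem, and by Schur's lemma any two of them give the same
  components.\<close>

definition isotypic :: "('a \<Rightarrow> 'a) set \<Rightarrow> (('a \<Rightarrow> 'a) \<Rightarrow> complex) \<Rightarrow> 'a set" where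
  "isotypic H = (THE D. is_isotypic H D)"

definition multiplicity_free :: "('a \<Rightarrow> 'a) set \<Rightarrow> bool" where
  "multiplicity_free H \<longleftrightarrow> (\<exists>n V. irreducible_decomposition H n V \<and>
     (\<forall>i<n. \<forall>j<n. i \<noteq> j \<longrightarrow> submodule_char H (V i) \<noteq> submodule_char H (V j)))"

text \<open>The isotypic decomposition of the conjugate \<open>g H g\<^sup>-\<^sup>1\<close>, relabelled by the characters
  of \<open>H\<close>.\<close>

definition conj_isotypic ::
  "('a \<Rightarrow> 'a) set \<Rightarrow> ('a \<Rightarrow> 'a) \<Rightarrow> (('a \<Rightarrow> 'a) \<Rightarrow> complex) \<Rightarrow> 'a set" where
  "conj_isotypic H g \<chi> = isotypic (conj_subgroup Aut g H) (conj_char Aut g H \<chi>)"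

subsection \<open>Decomposition algebras\<close>

definition fusion_decomposition :: "'x fusion_law \<Rightarrow> ('x \<Rightarrow> 'a set) \<Rightarrow> bool" where
  "fusion_decomposition \<Phi> D \<longleftrightarrow> direct_sum_decomposition (fst \<Phi>) D \<and>
     (\<forall>x\<in>fst \<Phi>. \<forall>y\<in>fst \<Phi>. \<forall>a\<in>D x. \<forall>b\<in>D y. a \<cdot> b \<in> sum_space (snd \<Phi> x y) D)"

definition decomposition_algebra ::
  "'x fusion_law \<Rightarrow> 'i set \<Rightarrow> ('i \<Rightarrow> 'x \<Rightarrow> 'a set) \<Rightarrow> bool" where
  "decomposition_algebra \<Phi> I \<Omega> \<longleftrightarrow> is_fusion_law \<Phi> \<and> (\<forall>i\<in>I. fusion_decomposition \<Phi> (\<Omega> i))"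

definition axis :: "'x fusion_law \<Rightarrow> 'x \<Rightarrow> ('x \<Rightarrow> 'a set) \<Rightarrow> 'a \<Rightarrow> bool" where
  "axis \<Phi> e D a \<longleftrightarrow> fusion_unit \<Phi> e \<and> a \<in> D e \<and> a \<noteq> 0 \<and>
     (\<forall>x\<in>fst \<Phi>. \<exists>c. \<forall>b\<in>D x. a \<cdot> b = c *s b)"

text \<open>The scalars \<open>c x\<close> are shared by all \<open>i\<close>, so the notion is sensitive to rescaling
  individual axes.\<close>

definition axial_decomposition_algebra ::
  "'x fusion_law \<Rightarrow> 'x \<Rightarrow> 'i set \<Rightarrow> ('i \<Rightarrow> 'x \<Rightarrow> 'a set) \<Rightarrow> ('i \<Rightarrow> 'a) \<Rightarrow> bool" where
  "axial_decomposition_algebra \<Phi> e I \<Omega> \<alpha> \<longleftrightarrow>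
     decomposition_algebra \<Phi> I \<Omega> \<and> fusion_unit \<Phi> e \<and>
     (\<exists>c. \<forall>i\<in>I. \<alpha> i \<in> \<Omega> i e \<and> \<alpha> i \<noteq> 0 \<and> (\<forall>x\<in>fst \<Phi>. \<forall>b\<in>\<Omega> i x. \<alpha> i \<cdot> b = c x *s b))"

end

end

theory Submission
  imports Defs "Jordan_Normal_Form.Spectral_Radius"
begin

text \<open>
  Everything rests on two facts about submodules of the algebra. Schur's lemma:
  a linear map that commutes with \<open>H\<close> and sends one irreducible submodule into another is zero or an
  isomorphism on it, and it is a scalar if the two are equal. Maschke's theorem: averaging over \<open>H\<close>
  makes any projection onto an invariant subspace commute with \<open>H\<close>, so invariant complements exist.

  Maschke's theorem gives a decomposition \<open>A = V 0 \<oplus> \<dots> \<oplus> V (n - 1)\<close> into irreducible submodules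
  (\<open>maschke\<close>); write \<open>P k\<close> for the projection onto \<open>V k\<close>, which commutes with \<open>H\<close>. An irreducible
  submodule \<open>W\<close> has a nonzero image under \<open>P k\<close> only if \<open>W\<close> and \<open>V k\<close> are isomorphic, and isomorphic
  submodules have equal characters. Hence \<open>W\<close> lies in the sum of the \<open>V k\<close> that share its
  character, and any two decompositions yield the same components (\<open>is_isotypic_unique\<close>).

  For the fusion rule take \<open>a\<close> in \<open>V i\<close> and \<open>b\<close> in \<open>V j\<close>. Since \<open>H\<close> acts by algebra automorphisms,
  \<open>a \<otimes> b \<mapsto> P k (a b)\<close> is a homomorphism of \<open>H\<close>-modules from \<open>V i \<otimes> V j\<close> to \<open>V k\<close>. If it is not
  zero then it is onto, and averaging a right inverse embeds \<open>V k\<close> into \<open>V i \<otimes> V j\<close>, so the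
  character of \<open>V k\<close> is a constituent of the product (\<open>constituent_of_product\<close>). This is
  carried out with matrices in coordinates, because representations and constituents are given
  by matrices.

  A trivial isotypic component consists of fixed vectors, so left multiplication by an element \<open>a\<close>
  of it commutes with \<open>H\<close>. It preserves each isotypic component because the trivial character
  is a unit, and if \<open>A\<close> is multiplicity-free these components are irreducible (or zero), so Schur's
  lemma makes it a scalar on each of them (\<open>axis_isotypic\<close>).

  Finally an automorphism \<open>f\<close> carries the decomposition for \<open>H\<close> to the one for \<open>f H f\<^sup>-\<^sup>1\<close>
  (\<open>conj_isotypic_decomposition\<close>) and keeps every scalar. If \<open>A\<close> is multiplicity-free, the trivial
  component is at most a line, so axes \<open>g i (b i)\<close> can be rescaled until all the \<open>b i\<close> are equal to
  one vector \<open>a\<close>; then all axes share the scalars of \<open>a\<close>.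
\<close>

section \<open>Sums of matrices and Kronecker products\<close>

text \<open>The dimensions are explicit parameters because a sum of matrices over an empty set would
  otherwise have no shape.\<close>

definition sum_mat :: "nat \<Rightarrow> nat \<Rightarrow> ('h \<Rightarrow> complex mat) \<Rightarrow> 'h set \<Rightarrow> complex mat" where
  "sum_mat m n M S = mat m n (\<lambda>(i, j). \<Sum>h\<in>S. M h $$ (i, j))"

lemma sum_mat_carrier [simp]: "sum_mat m n M S \<in> carrier_mat m n"
  by (simp add: sum_mat_def)

lemma sum_mat_cong: "(\<And>h. h \<in> S \<Longrightarrow> M h = N h) \<Longrightarrow> sum_mat m n M S = sum_mat m n N S"
  by (auto simp: sum_mat_def intro!: cong_mat sum.cong)

lemma sum_mat_reindex:
  assumes "bij_betw f S T"
  shows "sum_mat m n (\<lambda>h. M (f h)) S = sum_mat m n M T"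
  unfolding sum_mat_def
  using sum.reindex_bij_betw[OF assms, of "\<lambda>h. M h $$ (i, j)" for i j] by simp

lemma sum_mat_const: "A \<in> carrier_mat m n \<Longrightarrow> sum_mat m n (\<lambda>_. A) S = of_nat (card S) \<cdot>\<^sub>m A"
  by (intro eq_matI) (auto simp: sum_mat_def)

lemma mult_sum_mat:
  assumes A: "A \<in> carrier_mat k m" and M: "\<And>h. h \<in> S \<Longrightarrow> M h \<in> carrier_mat m n"
  shows "A * sum_mat m n M S = sum_mat k n (\<lambda>h. A * M h) S"
proof (rule eq_matI)
  fix i j assume "i < dim_row (sum_mat k n (\<lambda>h. A * M h) S)" "j < dim_col (sum_mat k n (\<lambda>h. A * M h) S)"
  then have ij: "i < k" "j < n" by (auto simp: sum_mat_def)
  have "(A * sum_mat m n M S) $$ (i, j) = (\<Sum>l<m. A $$ (i, l) * (\<Sum>h\<in>S. M h $$ (l, j)))"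
    using A ij by (auto simp: sum_mat_def scalar_prod_def lessThan_atLeast0 intro!: sum.cong)
  also have "\<dots> = (\<Sum>h\<in>S. \<Sum>l<m. A $$ (i, l) * M h $$ (l, j))"
    unfolding sum_distrib_left by (rule sum.swap)
  also have "\<dots> = (\<Sum>h\<in>S. (A * M h) $$ (i, j))"
  proof (rule sum.cong[OF refl])
    fix h assume "h \<in> S"
    from M[OF this] A ij show "(\<Sum>l<m. A $$ (i, l) * M h $$ (l, j)) = (A * M h) $$ (i, j)"
      by (auto simp: scalar_prod_def lessThan_atLeast0 intro!: sum.cong)
  qed
  finally show "(A * sum_mat m n M S) $$ (i, j) = sum_mat k n (\<lambda>h. A * M h) S $$ (i, j)"
    using ij by (simp add: sum_mat_def)
qed (use A in \<open>auto simp: sum_mat_def\<close>)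

lemma sum_mat_mult:
  assumes A: "A \<in> carrier_mat n k" and M: "\<And>h. h \<in> S \<Longrightarrow> M h \<in> carrier_mat m n"
  shows "sum_mat m n M S * A = sum_mat m k (\<lambda>h. M h * A) S"
proof (rule eq_matI)
  fix i j assume "i < dim_row (sum_mat m k (\<lambda>h. M h * A) S)" "j < dim_col (sum_mat m k (\<lambda>h. M h * A) S)"
  then have ij: "i < m" "j < k" by (auto simp: sum_mat_def)
  have "(sum_mat m n M S * A) $$ (i, j) = (\<Sum>l<n. (\<Sum>h\<in>S. M h $$ (i, l)) * A $$ (l, j))"
    using A ij by (auto simp: sum_mat_def scalar_prod_def lessThan_atLeast0 intro!: sum.cong)
  also have "\<dots> = (\<Sum>h\<in>S. \<Sum>l<n. M h $$ (i, l) * A $$ (l, j))"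
    unfolding sum_distrib_right by (rule sum.swap)
  also have "\<dots> = (\<Sum>h\<in>S. (M h * A) $$ (i, j))"
  proof (rule sum.cong[OF refl])
    fix h assume "h \<in> S"
    from M[OF this] A ij show "(\<Sum>l<n. M h $$ (i, l) * A $$ (l, j)) = (M h * A) $$ (i, j)"
      by (auto simp: scalar_prod_def lessThan_atLeast0 intro!: sum.cong)
  qed
  finally show "(sum_mat m n M S * A) $$ (i, j) = sum_mat m k (\<lambda>h. M h * A) S $$ (i, j)"
    using ij by (simp add: sum_mat_def)
qed (use A in \<open>auto simp: sum_mat_def\<close>)

text \<open>Kronecker products index the pair \<open>(i, j)\<close> by \<open>i * n + j\<close>; this turns sums over such an index
  back into double sums.\<close>

lemma sum_lessThan_mult_nat:
  fixes f :: "nat \<Rightarrow> nat \<Rightarrow> 'b::comm_monoid_add"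
  shows "(\<Sum>k<m * n. f (k div n) (k mod n)) = (\<Sum>i<m. \<Sum>j<n. f i j)"
proof (cases "n = 0")
  case False
  have "(\<Sum>i<m. \<Sum>j<n. f i j) = (\<Sum>i<m. \<Sum>k\<in>{i * n..<i * n + n}. f (k div n) (k mod n))"
  proof (rule sum.cong[OF refl])
    fix i
    have "(\<Sum>k\<in>{0 + i * n..<n + i * n}. f (k div n) (k mod n))
        = (\<Sum>j\<in>{0..<n}. f ((j + i * n) div n) ((j + i * n) mod n))"
      by (rule sum.shift_bounds_nat_ivl)
    also have "\<dots> = (\<Sum>j<n. f i j)"
      by (auto intro!: sum.cong simp: lessThan_atLeast0)
    finally show "(\<Sum>j<n. f i j) = (\<Sum>k\<in>{i * n..<i * n + n}. f (k div n) (k mod n))"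
      by (simp add: add.commute)
  qed
  also have "\<dots> = (\<Sum>k<m * n. f (k div n) (k mod n))"
    using sum.nat_group[of "\<lambda>k. f (k div n) (k mod n)" n m] by (simp add: mult.commute)
  finally show ?thesis ..
qed simp

lemma kronecker_carrier:
  "A \<in> carrier_mat m n \<Longrightarrow> B \<in> carrier_mat k l \<Longrightarrow> kronecker A B \<in> carrier_mat (m * k) (n * l)"
  by (simp add: kronecker_def)

lemma div_less_of_less_mult: "i < m * k \<Longrightarrow> i div k < (m::nat)"
  by (simp add: less_mult_imp_div_less)

lemma mod_less_of_less_mult: "i < m * k \<Longrightarrow> i mod k < (k::nat)"
  by (cases k) auto

lemma kronecker_index:
  assumes "A \<in> carrier_mat m n" "B \<in> carrier_mat k l" "i < m * k" "j < n * l"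
  shows "kronecker A B $$ (i, j) = A $$ (i div k, j div l) * B $$ (i mod k, j mod l)"
  using assms by (simp add: kronecker_def)

lemma mult_index:
  assumes "A \<in> carrier_mat m n" "B \<in> carrier_mat n k" "i < m" "j < k"
  shows "(A * B) $$ (i, j) = (\<Sum>l<n. A $$ (i, l) * B $$ (l, j))"
  using assms by (auto simp: scalar_prod_def lessThan_atLeast0 intro!: sum.cong)

lemma kronecker_mult:
  assumes A: "A \<in> carrier_mat m n" and B: "B \<in> carrier_mat k l"
    and C: "C \<in> carrier_mat n p" and D: "D \<in> carrier_mat l q"
  shows "kronecker A B * kronecker C D = kronecker (A * C) (B * D)"
proof (rule eq_matI)
  note AB = kronecker_carrier[OF A B] and CD = kronecker_carrier[OF C D]
  have AC: "A * C \<in> carrier_mat m p" and BD: "B * D \<in> carrier_mat k q" using assms by auto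
  note ACBD = kronecker_carrier[OF AC BD]
  show "dim_row (kronecker A B * kronecker C D) = dim_row (kronecker (A * C) (B * D))"
    "dim_col (kronecker A B * kronecker C D) = dim_col (kronecker (A * C) (B * D))"
    using AB CD ACBD by auto
  fix i j assume "i < dim_row (kronecker (A * C) (B * D))" "j < dim_col (kronecker (A * C) (B * D))"
  then have ij: "i < m * k" "j < p * q" using ACBD by auto
  let ?i1 = "i div k" and ?i2 = "i mod k" and ?j1 = "j div q" and ?j2 = "j mod q"
  have b: "?i1 < m" "?i2 < k" "?j1 < p" "?j2 < q"
    using ij by (auto intro: div_less_of_less_mult mod_less_of_less_mult)
  have "(kronecker A B * kronecker C D) $$ (i, j)
      = (\<Sum>r<n * l. (A $$ (?i1, r div l) * B $$ (?i2, r mod l)) * (C $$ (r div l, ?j1) * D $$ (r mod l, ?j2)))"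
    using ij by (simp add: mult_index[OF AB CD] kronecker_index[OF A B] kronecker_index[OF C D])
  also have "\<dots> = (\<Sum>s<n. \<Sum>t<l. (A $$ (?i1, s) * B $$ (?i2, t)) * (C $$ (s, ?j1) * D $$ (t, ?j2)))"
    by (rule sum_lessThan_mult_nat)
  also have "\<dots> = (A * C) $$ (?i1, ?j1) * (B * D) $$ (?i2, ?j2)"
    using b by (simp add: mult_index[OF A C] mult_index[OF B D] sum_product mult.commute mult.left_commute)
  also have "\<dots> = kronecker (A * C) (B * D) $$ (i, j)"
    using ij by (simp add: kronecker_index[OF AC BD])
  finally show "(kronecker A B * kronecker C D) $$ (i, j) = kronecker (A * C) (B * D) $$ (i, j)" .
qed

lemma matrix_rep_kronecker:
  assumes "matrix_rep G m \<rho>" "matrix_rep G n \<tau>"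
  shows "matrix_rep G (m * n) (\<lambda>g. kronecker (\<rho> g) (\<tau> g))"
proof -
  have "kronecker (1\<^sub>m m) (1\<^sub>m n) = (1\<^sub>m (m * n) :: complex mat)"
  proof (rule eq_matI)
    fix i j assume "i < dim_row (1\<^sub>m (m * n) :: complex mat)" "j < dim_col (1\<^sub>m (m * n) :: complex mat)"
    then have ij: "i < m * n" "j < m * n" by auto
    have "i = j \<longleftrightarrow> i div n = j div n \<and> i mod n = j mod n"
      by (metis div_mult_mod_eq)
    then show "kronecker (1\<^sub>m m) (1\<^sub>m n) $$ (i, j) = (1\<^sub>m (m * n) :: complex mat) $$ (i, j)"
      using ij by (auto simp: kronecker_index[of _ m m _ n n] div_less_of_less_mult mod_less_of_less_mult)
  qed (auto simp: kronecker_def)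
  moreover have "kronecker (\<rho> (g \<otimes>\<^bsub>G\<^esub> h)) (\<tau> (g \<otimes>\<^bsub>G\<^esub> h)) = kronecker (\<rho> g) (\<tau> g) * kronecker (\<rho> h) (\<tau> h)"
    if "g \<in> carrier G" "h \<in> carrier G" for g h
  proof -
    have "\<rho> g \<in> carrier_mat m m" "\<rho> h \<in> carrier_mat m m" "\<tau> g \<in> carrier_mat n n" "\<tau> h \<in> carrier_mat n n"
      using assms that by (auto simp: matrix_rep_def)
    from kronecker_mult[OF this(1,3,2,4)] show ?thesis
      using assms that by (simp add: matrix_rep_def)
  qed
  ultimately show ?thesis
    using assms by (auto simp: matrix_rep_def intro!: kronecker_carrier)
qed

section \<open>Constituents from intertwining matrices\<close>

lemma mult_mat_unit_vec:
  fixes A :: "complex mat"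
  assumes "A \<in> carrier_mat m n" "j < n"
  shows "A *\<^sub>v unit_vec n j = col A j"
  using assms by (intro eq_vecI) auto

text \<open>The image of an intertwining matrix is an invariant subspace of the target, so by irreducibility
  it is everything; preimages of the unit vectors are the columns of a right inverse, which
  averaging can turn into an intertwining matrix.\<close>

lemma intertwiner_onto_irreducible:
  assumes irr: "irreducible_rep G d \<rho>" and P: "P \<in> carrier_mat d m" and nz: "P \<noteq> 0\<^sub>m d m"
    and \<sigma>: "\<And>g. g \<in> carrier G \<Longrightarrow> \<sigma> g \<in> carrier_mat m m"
    and int: "\<And>g. g \<in> carrier G \<Longrightarrow> P * \<sigma> g = \<rho> g * P"
  obtains S where "S \<in> carrier_mat m d" "P * S = 1\<^sub>m d"
proof -
  define U where "U = (\<lambda>v. P *\<^sub>v v) ` carrier_vec m"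
  have \<rho>: "\<rho> g \<in> carrier_mat d d" if "g \<in> carrier G" for g
    using irr that by (auto simp: irreducible_rep_def matrix_rep_def)
  have "vec_subspace d U"
    unfolding vec_subspace_def
  proof (intro conjI ballI allI)
    show "U \<subseteq> carrier_vec d" using P by (auto simp: U_def)
    show "0\<^sub>v d \<in> U" unfolding U_def
      by (rule image_eqI[of _ _ "0\<^sub>v m"]) (use P in auto)
  next
    fix u v assume "u \<in> U" "v \<in> U"
    then obtain x y where "x \<in> carrier_vec m" "y \<in> carrier_vec m" "u = P *\<^sub>v x" "v = P *\<^sub>v y"
      by (auto simp: U_def)
    then show "u + v \<in> U" unfolding U_def
      by (intro image_eqI[of _ _ "x + y"]) (use P in \<open>auto simp: mult_add_distrib_mat_vec\<close>)
  next
    fix c u assume "u \<in> U"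
    then obtain x where "x \<in> carrier_vec m" "u = P *\<^sub>v x" by (auto simp: U_def)
    then show "c \<cdot>\<^sub>v u \<in> U" unfolding U_def
      by (intro image_eqI[of _ _ "c \<cdot>\<^sub>v x"]) (use P in \<open>auto simp: mult_mat_vec\<close>)
  qed
  moreover have "\<rho> g *\<^sub>v u \<in> U" if "g \<in> carrier G" "u \<in> U" for g u
  proof -
    from that obtain x where x: "x \<in> carrier_vec m" "u = P *\<^sub>v x" by (auto simp: U_def)
    have "\<rho> g *\<^sub>v u = P *\<^sub>v (\<sigma> g *\<^sub>v x)"
      using assoc_mult_mat_vec[OF P \<sigma>[OF that(1)] x(1)] assoc_mult_mat_vec[OF \<rho>[OF that(1)] P x(1)]
      by (simp add: int[OF that(1)] x(2))
    moreover have "\<sigma> g *\<^sub>v x \<in> carrier_vec m" using \<sigma>[OF that(1)] x by auto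
    ultimately show ?thesis by (auto simp: U_def)
  qed
  ultimately have "U = {0\<^sub>v d} \<or> U = carrier_vec d"
    using irr by (auto simp: irreducible_rep_def)
  \<comment> \<open>A zero image would make every column of \<open>P\<close> zero.\<close>
  moreover have "U \<noteq> {0\<^sub>v d}"
  proof
    assume U: "U = {0\<^sub>v d}"
    have "P = 0\<^sub>m d m"
    proof (rule eq_matI)
      fix i j assume "i < dim_row (0\<^sub>m d m :: complex mat)" "j < dim_col (0\<^sub>m d m :: complex mat)"
      then have ij: "i < d" "j < m" by auto
      have "P *\<^sub>v unit_vec m j = 0\<^sub>v d" using U ij by (auto simp: U_def)
      moreover have "P *\<^sub>v unit_vec m j = col P j" using P ij by auto
      ultimately have "col P j $ i = 0\<^sub>v d $ i" by simp
      then show "P $$ (i, j) = 0\<^sub>m d m $$ (i, j)" using P ij by auto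
    qed (use P in auto)
    with nz show False ..
  qed
  ultimately have onto: "U = carrier_vec d" by blast
  have "\<exists>s. s \<in> carrier_vec m \<and> P *\<^sub>v s = unit_vec d j" for j
  proof -
    have "unit_vec d j \<in> U" using onto by simp
    then show ?thesis unfolding U_def by auto
  qed
  then obtain s where s: "\<And>j. s j \<in> carrier_vec m" "\<And>j. P *\<^sub>v s j = unit_vec d j"
    by metis
  define S where "S = mat m d (\<lambda>(i, j). s j $ i)"
  have S: "S \<in> carrier_mat m d" by (simp add: S_def)
  have colS: "col S j = s j" if "j < d" for j
    using that s(1)[of j] by (auto simp: S_def)
  have "P * S = 1\<^sub>m d"
  proof (rule eq_matI)
    fix i j assume "i < dim_row (1\<^sub>m d :: complex mat)" "j < dim_col (1\<^sub>m d :: complex mat)"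
    then have ij: "i < d" "j < d" by auto
    have "(P * S) $$ (i, j) = (P *\<^sub>v s j) $ i" using P S ij colS by auto
    then show "(P * S) $$ (i, j) = 1\<^sub>m d $$ (i, j)" using ij by (simp add: s(2))
  qed (use P S in auto)
  with S show thesis by (rule that)
qed

text \<open>Maschke's theorem for a surjection: if \<open>P * S = 1\<close>, then the sum \<open>T\<close> of the matrices
  \<open>\<sigma> h * S * \<rho> (inv h)\<close> intertwines \<open>\<rho>\<close> and \<open>\<sigma>\<close>, and \<open>P * T\<close> is the order of the group times the
  identity, so \<open>T\<close> is injective.\<close>

lemma constituent_if_intertwiner_onto:
  assumes G: "group G" and fin: "finite (carrier G)"
    and rep: "matrix_rep G m \<sigma>" and irr: "irreducible_rep G d \<rho>"
    and P: "P \<in> carrier_mat d m" and nz: "P \<noteq> 0\<^sub>m d m"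
    and int: "\<And>g. g \<in> carrier G \<Longrightarrow> P * \<sigma> g = \<rho> g * P"
  shows "constituent G m \<sigma> (rep_char G d \<rho>)"
proof -
  interpret group G by (rule G)
  have \<sigma>: "\<And>g. g \<in> carrier G \<Longrightarrow> \<sigma> g \<in> carrier_mat m m"
    and \<sigma>_mult: "\<And>g h. g \<in> carrier G \<Longrightarrow> h \<in> carrier G \<Longrightarrow> \<sigma> (g \<otimes>\<^bsub>G\<^esub> h) = \<sigma> g * \<sigma> h"
    using rep by (auto simp: matrix_rep_def)
  have \<rho>: "\<And>g. g \<in> carrier G \<Longrightarrow> \<rho> g \<in> carrier_mat d d"
    and \<rho>_mult: "\<And>g h. g \<in> carrier G \<Longrightarrow> h \<in> carrier G \<Longrightarrow> \<rho> (g \<otimes>\<^bsub>G\<^esub> h) = \<rho> g * \<rho> h"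
    and \<rho>_one: "\<rho> \<one>\<^bsub>G\<^esub> = 1\<^sub>m d"
    using irr by (auto simp: irreducible_rep_def matrix_rep_def)
  obtain S where S: "S \<in> carrier_mat m d" and PS: "P * S = 1\<^sub>m d"
    using intertwiner_onto_irreducible[OF irr P nz \<sigma> int] by blast
  define M where "M = (\<lambda>h. \<sigma> h * (S * \<rho> (inv\<^bsub>G\<^esub> h)))"
  define T where "T = sum_mat m d M (carrier G)"
  have M: "M h \<in> carrier_mat m d" if "h \<in> carrier G" for h
    using \<sigma>[OF that] S \<rho>[OF inv_closed[OF that]] unfolding M_def by auto
  have T: "T \<in> carrier_mat m d" by (simp add: T_def)
  have PM: "P * M h = 1\<^sub>m d" if h: "h \<in> carrier G" for h
  proof -
    note hi = inv_closed[OF h]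
    have "P * M h = (P * \<sigma> h) * (S * \<rho> (inv\<^bsub>G\<^esub> h))"
      unfolding M_def using P \<sigma>[OF h] S \<rho>[OF hi] by (intro assoc_mult_mat[symmetric]) auto
    also have "\<dots> = \<rho> h * (P * (S * \<rho> (inv\<^bsub>G\<^esub> h)))"
      unfolding int[OF h] using P \<rho>[OF h] S \<rho>[OF hi] by (intro assoc_mult_mat) auto
    also have "P * (S * \<rho> (inv\<^bsub>G\<^esub> h)) = \<rho> (inv\<^bsub>G\<^esub> h)"
      using assoc_mult_mat[OF P S \<rho>[OF hi]] \<rho>[OF hi] by (simp add: PS)
    also have "\<rho> h * \<rho> (inv\<^bsub>G\<^esub> h) = 1\<^sub>m d"
      using \<rho>_mult[OF h hi] h by (simp add: \<rho>_one)
    finally show ?thesis .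
  qed
  have PT: "P * T = of_nat (card (carrier G)) \<cdot>\<^sub>m 1\<^sub>m d"
  proof -
    have "P * T = sum_mat d d (\<lambda>h. P * M h) (carrier G)"
      unfolding T_def by (rule mult_sum_mat[OF P M])
    also have "\<dots> = sum_mat d d (\<lambda>_. 1\<^sub>m d) (carrier G)"
      by (rule sum_mat_cong) (rule PM)
    finally show ?thesis by (simp add: sum_mat_const)
  qed
  have "card (carrier G) \<noteq> 0"
    using fin one_closed by auto
  have inj: "v = 0\<^sub>v d" if v: "v \<in> carrier_vec d" "T *\<^sub>v v = 0\<^sub>v m" for v
  proof -
    have "of_nat (card (carrier G)) \<cdot>\<^sub>v v = (P * T) *\<^sub>v v"
      unfolding PT using v(1) by (intro eq_vecI) auto
    also have "\<dots> = P *\<^sub>v (T *\<^sub>v v)" using P T v(1) by (rule assoc_mult_mat_vec)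
    also have "\<dots> = 0\<^sub>v d" using v(2) P by auto
    finally have eq: "(of_nat (card (carrier G)) :: complex) \<cdot>\<^sub>v v = 0\<^sub>v d" .
    show ?thesis
    proof (rule eq_vecI)
      fix i assume "i < dim_vec (0\<^sub>v d :: complex vec)"
      then have i: "i < d" by simp
      have "(of_nat (card (carrier G)) \<cdot>\<^sub>v v) $ i = 0" using eq i by simp
      then show "v $ i = 0\<^sub>v d $ i" using i v(1) \<open>card (carrier G) \<noteq> 0\<close> by simp
    qed (use v in auto)
  qed
  have "T * \<rho> g = \<sigma> g * T" if g: "g \<in> carrier G" for g
  proof -
    have bij: "bij_betw (\<lambda>h. g \<otimes>\<^bsub>G\<^esub> h) (carrier G) (carrier G)"
      by (rule bij_betw_byWitness[where f' = "\<lambda>h. inv\<^bsub>G\<^esub> g \<otimes>\<^bsub>G\<^esub> h"])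
         (use g in \<open>auto simp: m_assoc[symmetric]\<close>)
    have "T * \<rho> g = sum_mat m d (\<lambda>h. M h * \<rho> g) (carrier G)"
      unfolding T_def by (rule sum_mat_mult[OF \<rho>[OF g] M])
    also have "\<dots> = sum_mat m d (\<lambda>h. M (g \<otimes>\<^bsub>G\<^esub> h) * \<rho> g) (carrier G)"
      using sum_mat_reindex[OF bij, of m d "\<lambda>h. M h * \<rho> g"] by simp
    also have "\<dots> = sum_mat m d (\<lambda>h. \<sigma> g * M h) (carrier G)"
    proof (rule sum_mat_cong)
      fix h assume h: "h \<in> carrier G"
      have gh: "g \<otimes>\<^bsub>G\<^esub> h \<in> carrier G" using g h by simp
      note c = \<sigma>[OF g] \<sigma>[OF h] \<sigma>[OF gh] S \<rho>[OF g] \<rho>[OF inv_closed[OF gh]] \<rho>[OF inv_closed[OF h]]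
      have "\<rho> (inv\<^bsub>G\<^esub> (g \<otimes>\<^bsub>G\<^esub> h)) * \<rho> g = \<rho> (inv\<^bsub>G\<^esub> h)"
        using \<rho>_mult[OF inv_closed[OF gh] g] g h by (simp add: inv_mult_group m_assoc)
      moreover have "M (g \<otimes>\<^bsub>G\<^esub> h) * \<rho> g = \<sigma> (g \<otimes>\<^bsub>G\<^esub> h) * (S * (\<rho> (inv\<^bsub>G\<^esub> (g \<otimes>\<^bsub>G\<^esub> h)) * \<rho> g))"
        unfolding M_def using c by (subst assoc_mult_mat, auto)
      ultimately have "M (g \<otimes>\<^bsub>G\<^esub> h) * \<rho> g = (\<sigma> g * \<sigma> h) * (S * \<rho> (inv\<^bsub>G\<^esub> h))"
        by (simp add: \<sigma>_mult[OF g h])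
      also have "\<dots> = \<sigma> g * M h" unfolding M_def
        using c by (intro assoc_mult_mat) auto
      finally show "M (g \<otimes>\<^bsub>G\<^esub> h) * \<rho> g = \<sigma> g * M h" .
    qed
    also have "\<dots> = \<sigma> g * T"
      unfolding T_def by (rule mult_sum_mat[OF \<sigma>[OF g] M, symmetric])
    finally show ?thesis .
  qed
  then show ?thesis
    unfolding constituent_def using irr T inj by blast
qed

lemma trace_intertwined:
  assumes T: "T \<in> carrier_mat n d" and S: "S \<in> carrier_mat d n"
    and TS: "T * S = 1\<^sub>m n" and ST: "S * T = 1\<^sub>m d"
    and A: "A \<in> carrier_mat d d" and B: "B \<in> carrier_mat n n" and int: "T * A = B * T"
  shows "(\<Sum>i<d. A $$ (i, i)) = (\<Sum>i<n. (B $$ (i, i) :: complex))"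
proof -
  have A_eq: "A = S * (B * T)"
    using assoc_mult_mat[OF S T A] ST A by (simp add: int)
  have B_eq: "B = B * T * S"
    using assoc_mult_mat[OF B T S] TS B by simp
  have BT: "B * T \<in> carrier_mat n d" using B T by auto
  have "(\<Sum>i<d. A $$ (i, i)) = (\<Sum>i<d. \<Sum>l<n. S $$ (i, l) * (B * T) $$ (l, i))"
    by (subst A_eq) (auto intro!: sum.cong simp: mult_index[OF S BT] simp del: index_mult_mat)
  also have "\<dots> = (\<Sum>l<n. \<Sum>i<d. (B * T) $$ (l, i) * S $$ (i, l))"
    by (subst sum.swap) (simp add: mult.commute)
  also have "\<dots> = (\<Sum>i<n. B $$ (i, i))"
    using arg_cong[OF B_eq, of "\<lambda>M. M $$ (i, i)" for i]
    by (auto intro!: sum.cong simp: mult_index[OF BT S] simp del: index_mult_mat)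
  finally show ?thesis .
qed

text \<open>The embedding that exhibits a constituent of an irreducible representation is onto, hence
  invertible, and conjugate matrices have the same trace.\<close>

lemma constituent_of_irreducible:
  assumes irr: "irreducible_rep G n \<sigma>" and con: "constituent G n \<sigma> \<chi>"
  shows "\<chi> = rep_char G n \<sigma>"
proof -
  from con obtain d \<rho> T where \<rho>: "irreducible_rep G d \<rho>" and \<chi>: "\<chi> = rep_char G d \<rho>"
    and T: "T \<in> carrier_mat n d" and inj: "\<And>v. v \<in> carrier_vec d \<Longrightarrow> T *\<^sub>v v = 0\<^sub>v n \<Longrightarrow> v = 0\<^sub>v d"
    and int: "\<And>g. g \<in> carrier G \<Longrightarrow> T * \<rho> g = \<sigma> g * T"
    unfolding constituent_def by blast
  have \<rho>c: "\<And>g. g \<in> carrier G \<Longrightarrow> \<rho> g \<in> carrier_mat d d" and d: "d \<noteq> 0"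
    using \<rho> by (auto simp: irreducible_rep_def matrix_rep_def)
  have \<sigma>c: "\<And>g. g \<in> carrier G \<Longrightarrow> \<sigma> g \<in> carrier_mat n n"
    using irr by (auto simp: irreducible_rep_def matrix_rep_def)
  have "T \<noteq> 0\<^sub>m n d"
  proof
    assume T0: "T = 0\<^sub>m n d"
    have "T *\<^sub>v unit_vec d 0 = 0\<^sub>v n" unfolding T0
      by (intro eq_vecI) (auto simp: scalar_prod_def)
    then have "unit_vec d 0 = (0\<^sub>v d :: complex vec)" using inj by simp
    then have "unit_vec d 0 $ 0 = (0\<^sub>v d :: complex vec) $ 0" by simp
    then show False using d by simp
  qed
  then obtain S where S: "S \<in> carrier_mat d n" and TS: "T * S = 1\<^sub>m n"
    using intertwiner_onto_irreducible[OF irr T _ \<rho>c int] by blast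
  have ST: "S * T = 1\<^sub>m d"
  proof (rule eq_matI)
    fix i j assume "i < dim_row (1\<^sub>m d :: complex mat)" "j < dim_col (1\<^sub>m d :: complex mat)"
    then have ij: "i < d" "j < d" by auto
    \<comment> \<open>A right inverse of an injective matrix is also a left inverse: \<open>T\<close> maps \<open>w\<close> to zero.\<close>
    define w where "w = S *\<^sub>v (T *\<^sub>v unit_vec d j) - unit_vec d j"
    have w: "w \<in> carrier_vec d" using S T by (auto simp: w_def)
    have "T *\<^sub>v w = T *\<^sub>v (S *\<^sub>v (T *\<^sub>v unit_vec d j)) - T *\<^sub>v unit_vec d j"
      unfolding w_def using S T by (intro mult_minus_distrib_mat_vec) auto
    also have "T *\<^sub>v (S *\<^sub>v (T *\<^sub>v unit_vec d j)) = (T * S) *\<^sub>v (T *\<^sub>v unit_vec d j)"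
      using S T by (intro assoc_mult_mat_vec[symmetric]) auto
    finally have "T *\<^sub>v w = 0\<^sub>v n" using T by (auto simp: TS)
    then have w0: "w = 0\<^sub>v d" using inj w by blast
    have "S *\<^sub>v (T *\<^sub>v unit_vec d j) = (S * T) *\<^sub>v unit_vec d j"
      using S T by (intro assoc_mult_mat_vec[symmetric]) auto
    also have "\<dots> = col (S * T) j" by (rule mult_mat_unit_vec) (use S T ij in auto)
    finally have "w $ i = (S * T) $$ (i, j) - unit_vec d j $ i"
      using ij S T by (simp add: w_def)
    then show "(S * T) $$ (i, j) = 1\<^sub>m d $$ (i, j)" using ij w0 by simp
  qed (use S T in auto)
  have "(\<Sum>i<d. \<rho> g $$ (i, i)) = (\<Sum>i<n. \<sigma> g $$ (i, i))" if "g \<in> carrier G" for g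
    by (rule trace_intertwined[OF T S TS ST \<rho>c[OF that] \<sigma>c[OF that] int[OF that]])
  then show ?thesis unfolding \<chi> rep_char_def by (intro restrict_ext)
qed

section \<open>The representation fusion law and its unit\<close>

lemma is_fusion_law_rep: "is_fusion_law (rep_fusion_law G)"
  by (auto simp: is_fusion_law_def rep_fusion_law_def Irr_def constituent_def)

text \<open>The value of a character at the identity is the dimension, so a representation with trivial
  character is one-dimensional, and its only matrix entry is the character value.\<close>

lemma rep_of_trivial_char:
  assumes G: "group G" and \<rho>: "matrix_rep G n \<rho>" and triv: "rep_char G n \<rho> = trivial_char G"
  shows "n = 1" and "g \<in> carrier G \<Longrightarrow> \<rho> g = 1\<^sub>m 1"
proof -
  interpret group G by (rule G)
  have char: "(\<Sum>i<n. \<rho> g $$ (i, i)) = 1" if "g \<in> carrier G" for g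
    using fun_cong[OF triv, of g] that by (simp add: rep_char_def trivial_char_def)
  have "of_nat n = (1 :: complex)"
    using char[OF one_closed] \<rho> by (simp add: matrix_rep_def)
  then show n: "n = 1" using of_nat_eq_1_iff by blast
  assume g: "g \<in> carrier G"
  then have "\<rho> g \<in> carrier_mat 1 1" using \<rho> n by (auto simp: matrix_rep_def)
  then show "\<rho> g = 1\<^sub>m 1" using char[OF g] by (intro eq_matI) (auto simp: n)
qed

lemma trivial_char_in_Irr:
  assumes "group G"
  shows "trivial_char G \<in> Irr G"
proof -
  interpret group G by (rule assms)
  let ?\<rho> = "\<lambda>_. 1\<^sub>m 1 :: complex mat"
  have "U = {0\<^sub>v 1} \<or> U = carrier_vec 1" if U: "vec_subspace 1 U" for U
  proof (cases "U \<subseteq> {0\<^sub>v 1}")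
    case True
    then show ?thesis using U by (auto simp: vec_subspace_def)
  next
    case False
    then obtain u where u: "u \<in> U" "u \<noteq> 0\<^sub>v 1" by auto
    then have uc: "u \<in> carrier_vec 1" using U by (auto simp: vec_subspace_def)
    have u0: "u $ 0 \<noteq> 0"
    proof
      assume "u $ 0 = 0"
      then have "u = 0\<^sub>v 1" using uc by (intro eq_vecI) auto
      with u show False by simp
    qed
    have "v \<in> U" if v: "v \<in> carrier_vec 1" for v
    proof -
      have "v = (v $ 0 / u $ 0) \<cdot>\<^sub>v u" using uc v u0 by (intro eq_vecI) auto
      then show ?thesis using U u(1) by (metis vec_subspace_def)
    qed
    then show ?thesis using U by (auto simp: vec_subspace_def)
  qed
  then have "irreducible_rep G 1 ?\<rho>"
    by (auto simp: irreducible_rep_def matrix_rep_def)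
  moreover have "trivial_char G = rep_char G 1 ?\<rho>"
    by (simp add: trivial_char_def rep_char_def)
  ultimately show ?thesis unfolding Irr_def by blast
qed

text \<open>The Kronecker product of \<open>\<rho>\<close> with the one-by-one identity matrix, on either side, is \<open>\<rho>\<close> itself,
  whose only constituent is its own character.\<close>

lemma fusion_unit_trivial_char:
  assumes G: "group G"
  shows "fusion_unit (rep_fusion_law G) (trivial_char G)"
proof -
  have left: "\<chi> = rep_char G n2 \<rho>2"
    if "irreducible_rep G n1 \<rho>1" "trivial_char G = rep_char G n1 \<rho>1" "irreducible_rep G n2 \<rho>2"
      "constituent G (n1 * n2) (\<lambda>g. kronecker (\<rho>1 g) (\<rho>2 g)) \<chi>" for \<chi> n1 n2 \<rho>1 \<rho>2
  proof -
    have rep: "matrix_rep G n1 \<rho>1" "matrix_rep G n2 \<rho>2"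
      using that by (auto simp: irreducible_rep_def)
    have n1: "n1 = 1" and one: "\<And>g. g \<in> carrier G \<Longrightarrow> \<rho>1 g = 1\<^sub>m 1"
      using rep_of_trivial_char[OF G rep(1)] that(2) by auto
    have "kronecker (\<rho>1 g) (\<rho>2 g) = \<rho>2 g" if g: "g \<in> carrier G" for g
    proof -
      have "\<rho>2 g \<in> carrier_mat n2 n2" using rep g by (auto simp: matrix_rep_def)
      then show ?thesis unfolding one[OF g] by (intro eq_matI) (auto simp: kronecker_def)
    qed
    then have "constituent G n2 \<rho>2 \<chi>"
      using that(4) unfolding constituent_def n1 by simp
    then show ?thesis by (rule constituent_of_irreducible[OF that(3)])
  qed
  have right: "\<chi> = rep_char G n2 \<rho>2"
    if "irreducible_rep G n1 \<rho>1" "trivial_char G = rep_char G n1 \<rho>1" "irreducible_rep G n2 \<rho>2"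
      "constituent G (n2 * n1) (\<lambda>g. kronecker (\<rho>2 g) (\<rho>1 g)) \<chi>" for \<chi> n1 n2 \<rho>1 \<rho>2
  proof -
    have rep: "matrix_rep G n1 \<rho>1" "matrix_rep G n2 \<rho>2"
      using that by (auto simp: irreducible_rep_def)
    have n1: "n1 = 1" and one: "\<And>g. g \<in> carrier G \<Longrightarrow> \<rho>1 g = 1\<^sub>m 1"
      using rep_of_trivial_char[OF G rep(1)] that(2) by auto
    have "kronecker (\<rho>2 g) (\<rho>1 g) = \<rho>2 g" if g: "g \<in> carrier G" for g
    proof -
      have "\<rho>2 g \<in> carrier_mat n2 n2" using rep g by (auto simp: matrix_rep_def)
      then show ?thesis unfolding one[OF g] by (intro eq_matI) (auto simp: kronecker_def)
    qed
    then have "constituent G n2 \<rho>2 \<chi>"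
      using that(4) unfolding constituent_def n1 by simp
    then show ?thesis by (rule constituent_of_irreducible[OF that(3)])
  qed
  show ?thesis
    unfolding fusion_unit_def rep_fusion_law_def fst_conv snd_conv
  proof (intro conjI ballI subsetI)
    show "trivial_char G \<in> Irr G" by (rule trivial_char_in_Irr[OF G])
  next
    fix x \<chi> assume "\<chi> \<in> {\<chi>. \<exists>n1 \<rho>1 n2 \<rho>2. irreducible_rep G n1 \<rho>1 \<and> trivial_char G = rep_char G n1 \<rho>1 \<and>
      irreducible_rep G n2 \<rho>2 \<and> x = rep_char G n2 \<rho>2 \<and>
      constituent G (n1 * n2) (\<lambda>g. kronecker (\<rho>1 g) (\<rho>2 g)) \<chi>}"
    then show "\<chi> \<in> {x}" using left by blast
  next
    fix x \<chi> assume "\<chi> \<in> {\<chi>. \<exists>n1 \<rho>1 n2 \<rho>2. irreducible_rep G n1 \<rho>1 \<and> x = rep_char G n1 \<rho>1 \<and>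
      irreducible_rep G n2 \<rho>2 \<and> trivial_char G = rep_char G n2 \<rho>2 \<and>
      constituent G (n1 * n2) (\<lambda>g. kronecker (\<rho>1 g) (\<rho>2 g)) \<chi>}"
    then show "\<chi> \<in> {x}" using right by blast
  qed
qed

section \<open>Direct sums and their projections\<close>

context fd_algebra
begin

abbreviation lin :: "('a \<Rightarrow> 'a) \<Rightarrow> bool" where
  "lin f \<equiv> Vector_Spaces.linear scale scale f"

interpretation pair: vector_space_pair scale scale ..

lemmas lin_add = pair.linear_add and lin_scale = pair.linear_scale and lin_zero = pair.linear_0
  and lin_diff = pair.linear_diff and lin_sum = pair.linear_sum

lemma linI: "(\<And>u v. f (u + v) = f u + f v) \<Longrightarrow> (\<And>c u. f (c *s u) = c *s f u) \<Longrightarrow> lin f"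
  by (simp add: Vector_Spaces.linear_iff vector_space_axioms)

lemma lin_compose: "lin f \<Longrightarrow> lin g \<Longrightarrow> lin (\<lambda>v. f (g v))"
  by (rule linI) (simp_all add: lin_add lin_scale)

lemma lin_sum_maps: "(\<And>i. i \<in> S \<Longrightarrow> lin (f i)) \<Longrightarrow> lin (\<lambda>v. \<Sum>i\<in>S. f i v)"
  by (rule linI) (simp_all add: lin_add lin_scale sum.distrib scale_sum_right)

text \<open>Internal direct sums are handled through their projections: these are linear, can be composed
  with other maps, and make uniqueness of components automatic. For an infinite
  index set only finitely many components of each vector may be nonzero.\<close>

definition projections :: "'x set \<Rightarrow> ('x \<Rightarrow> 'a set) \<Rightarrow> ('x \<Rightarrow> 'a \<Rightarrow> 'a) \<Rightarrow> bool" where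
  "projections X D P \<longleftrightarrow>
     (\<forall>x\<in>X. lin (P x) \<and> (\<forall>v. P x v \<in> D x) \<and> (\<forall>v\<in>D x. P x v = v)) \<and>
     (\<forall>x\<in>X. \<forall>y\<in>X. x \<noteq> y \<longrightarrow> (\<forall>v\<in>D x. P y v = 0)) \<and>
     (\<forall>v. finite {x\<in>X. P x v \<noteq> 0} \<and> v = (\<Sum>x\<in>{x\<in>X. P x v \<noteq> 0}. P x v))"

lemma projectionsD:
  assumes "projections X D P" "x \<in> X"
  shows "lin (P x)" "P x v \<in> D x" "v \<in> D x \<Longrightarrow> P x v = v"
    "y \<in> X \<Longrightarrow> y \<noteq> x \<Longrightarrow> v \<in> D y \<Longrightarrow> P x v = 0"
  using assms by (simp_all add: projections_def)

definition components :: "'x set \<Rightarrow> ('x \<Rightarrow> 'a set) \<Rightarrow> 'a \<Rightarrow> ('x \<Rightarrow> 'a) \<Rightarrow> bool" where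
  "components X D v f \<longleftrightarrow> (\<forall>x. f x \<in> (if x \<in> X then D x else {0})) \<and>
     finite {x. f x \<noteq> 0} \<and> v = (\<Sum>x | f x \<noteq> 0. f x)"

lemma componentsI:
  assumes "\<And>x. x \<in> X \<Longrightarrow> f x \<in> D x" "\<And>x. x \<notin> X \<Longrightarrow> f x = 0"
    and "finite S" "\<And>x. x \<notin> S \<Longrightarrow> f x = 0" "v = sum f S"
  shows "components X D v f"
proof -
  have sub: "{x. f x \<noteq> 0} \<subseteq> S" using assms(4) by blast
  then have "sum f S = (\<Sum>x | f x \<noteq> 0. f x)"
    by (intro sum.mono_neutral_right) (use assms(3) in auto)
  then show ?thesis using assms sub finite_subset[OF sub] by (auto simp: components_def)
qed

lemma direct_sum_decomposition_components:
  "direct_sum_decomposition X D \<longleftrightarrow> (\<forall>x\<in>X. subspace (D x)) \<and> (\<forall>v. \<exists>!f. components X D v f)"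
  unfolding direct_sum_decomposition_def components_def ..

lemma direct_sum_decompositionI:
  assumes sub: "\<And>x. x \<in> X \<Longrightarrow> subspace (D x)" and P: "projections X D P"
  shows "direct_sum_decomposition X D"
  unfolding direct_sum_decomposition_components
proof (intro conjI ballI allI)
  fix v
  have lin: "lin (P x)" and mem: "P x w \<in> D x" and fixed: "w \<in> D x \<Longrightarrow> P x w = w"
    and kill: "y \<in> X \<Longrightarrow> x \<noteq> y \<Longrightarrow> w \<in> D x \<Longrightarrow> P y w = 0" if "x \<in> X" for x y w
    using P that by (auto simp: projections_def)
  let ?S = "{x\<in>X. P x v \<noteq> 0}"
  have fin: "finite ?S" and v: "v = (\<Sum>x\<in>?S. P x v)"
    using P unfolding projections_def by blast+
  show "\<exists>!f. components X D v f"
  proof (rule ex1I[of _ "\<lambda>x. if x \<in> X then P x v else 0"])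
    show "components X D v (\<lambda>x. if x \<in> X then P x v else 0)"
      using fin mem by (intro componentsI[where S = ?S]) (auto intro: trans[OF v])
  next
    fix f assume f: "components X D v f"
    have fD: "f x \<in> D x" if "x \<in> X" for x using f that unfolding components_def by metis
    have f0: "f x = 0" if "x \<notin> X" for x using f that unfolding components_def by (metis singletonD)
    have finf: "finite {x. f x \<noteq> 0}" and vf: "v = (\<Sum>x | f x \<noteq> 0. f x)"
      using f by (auto simp: components_def)
    show "f = (\<lambda>x. if x \<in> X then P x v else 0)"
    proof
      fix y show "f y = (if y \<in> X then P y v else 0)"
      proof (cases "y \<in> X")
        case True
        have "P y v = (\<Sum>x | f x \<noteq> 0. P y (f x))"
          by (subst vf) (rule lin_sum[OF lin[OF True]])
        also have "\<dots> = (\<Sum>x | f x \<noteq> 0. if x = y then f y else 0)"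
        proof (intro sum.cong refl)
          fix x assume "x \<in> {x. f x \<noteq> 0}"
          then have "x \<in> X" using f0 by auto
          then show "P y (f x) = (if x = y then f y else 0)"
            using fixed[OF True] kill[OF _ True] fD by auto
        qed
        also have "\<dots> = f y" using finf by simp
        finally show ?thesis using True by simp
      qed (simp add: f0)
    qed
  qed
qed (use sub in auto)

text \<open>The projections are read off from the unique families of components; their linearity follows
  from uniqueness, since the componentwise sum of two families is the family of the sum.\<close>

lemma direct_sum_decompositionE:
  assumes "direct_sum_decomposition X D"
  obtains P where "projections X D P"
proof -
  have sub: "subspace (D x)" if "x \<in> X" for x
    using assms that by (simp add: direct_sum_decomposition_components)
  have ex1: "\<exists>!f. components X D v f" for v
    using assms by (simp add: direct_sum_decomposition_components)
  define F where "F v = (THE f. components X D v f)" for v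
  have F: "components X D v (F v)" for v unfolding F_def by (rule theI'[OF ex1])
  have F_eq: "F v = f" if "components X D v f" for v f
    using ex1 F that by blast
  have mem: "F v x \<in> D x" if "x \<in> X" for x v using F[of v] that unfolding components_def by metis
  have out: "F v x = 0" if "x \<notin> X" for x v
    using F[of v] that unfolding components_def by (metis singletonD)
  have fin: "finite {x. F v x \<noteq> 0}" and sm: "v = (\<Sum>x | F v x \<noteq> 0. F v x)" for v
    using F[of v] by (auto simp: components_def)
  have sm': "v = sum (F v) S" if "finite S" "{x. F v x \<noteq> 0} \<subseteq> S" for v S
    by (rule trans[OF sm]) (intro sum.mono_neutral_left, use that in auto)
  have add: "F (u + v) = (\<lambda>x. F u x + F v x)" for u v
  proof (rule F_eq, rule componentsI[where S = "{x. F u x \<noteq> 0} \<union> {x. F v x \<noteq> 0}"])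
    let ?S = "{x. F u x \<noteq> 0} \<union> {x. F v x \<noteq> 0}"
    have "u = sum (F u) ?S" "v = sum (F v) ?S" using fin by (auto intro: sm')
    then have "u + v = sum (F u) ?S + sum (F v) ?S" by (rule arg_cong2[where f = "(+)"])
    then show "u + v = (\<Sum>x\<in>?S. F u x + F v x)" by (simp only: sum.distrib)
  qed (use mem out fin sub in \<open>auto intro: subspace_add\<close>)
  have scl: "F (c *s v) = (\<lambda>x. c *s F v x)" for c v
  proof (rule F_eq, rule componentsI[where S = "{x. F v x \<noteq> 0}"])
    show "c *s v = (\<Sum>x | F v x \<noteq> 0. c *s F v x)"
      by (subst sm) (rule scale_sum_right)
  qed (use mem out fin sub in \<open>auto intro: subspace_scale\<close>)
  have base: "F v = (\<lambda>x. if x = y then v else 0)" if "y \<in> X" "v \<in> D y" for y v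
    by (rule F_eq, rule componentsI[where S = "{y}"])
       (use that sub in \<open>auto intro: subspace_0\<close>)
  have supp: "{x\<in>X. F v x \<noteq> 0} = {x. F v x \<noteq> 0}" for v using out by auto
  have "projections X D (\<lambda>x v. F v x)"
    unfolding projections_def supp
  proof (intro conjI ballI allI impI)
    fix x show "lin (\<lambda>v. F v x)" by (rule linI) (simp_all add: add scl)
  qed (use mem base fin sm in auto)
  then show thesis by (rule that)
qed

lemma projections_lessThan_sum:
  assumes "projections {..<n::nat} V P"
  shows "(\<Sum>i<n. P i v) = v"
proof -
  have "v = (\<Sum>i\<in>{i\<in>{..<n}. P i v \<noteq> 0}. P i v)" using assms unfolding projections_def by blast
  also have "\<dots> = (\<Sum>i<n. P i v)" by (rule sum.mono_neutral_left) auto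
  finally show ?thesis ..
qed

lemma direct_sum_decomposition_lessThanI:
  fixes n :: nat
  assumes sub: "\<And>i. i < n \<Longrightarrow> subspace (V i)"
    and ex: "\<And>v. \<exists>f. (\<forall>i<n. f i \<in> V i) \<and> v = (\<Sum>i<n. f i)"
    and indep: "\<And>f. (\<forall>i<n. f i \<in> V i) \<Longrightarrow> (\<Sum>i<n. f i) = 0 \<Longrightarrow> \<forall>i<n. f i = 0"
  shows "direct_sum_decomposition {..<n} V"
  unfolding direct_sum_decomposition_components
proof (intro conjI ballI allI)
  fix v
  obtain f where f: "\<forall>i<n. f i \<in> V i" "v = (\<Sum>i<n. f i)" using ex by blast
  let ?f = "\<lambda>i. if i < n then f i else 0"
  show "\<exists>!f. components {..<n} V v f"
  proof (rule ex1I[of _ ?f])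
    show "components {..<n} V v ?f"
      by (rule componentsI[where S = "{..<n}"]) (use f in auto)
  next
    fix g assume g: "components {..<n} V v g"
    have gV: "g i \<in> V i" if "i < n" for i using g that unfolding components_def by (metis lessThan_iff)
    have g0: "g i = 0" if "\<not> i < n" for i using g that unfolding components_def by (metis lessThan_iff singletonD)
    have "v = (\<Sum>i | g i \<noteq> 0. g i)" using g by (auto simp: components_def)
    also have "\<dots> = (\<Sum>i<n. g i)" by (rule sum.mono_neutral_left) (use g0 in auto)
    \<comment> \<open>Two expansions of \<open>v\<close> differ by an expansion of zero.\<close>
    finally have "(\<Sum>i<n. f i - g i) = 0" using f by (simp add: sum_subtractf)
    then have "\<forall>i<n. f i - g i = 0"
      using f gV sub by (intro indep) (auto intro: subspace_diff)
    then show "g = ?f" using g0 by auto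
  qed
qed (use sub in auto)

section \<open>Coordinates and traces on subspaces\<close>

text \<open>A basis is enumerated by an initial segment of the natural numbers to match the
  indexing of matrices.\<close>

definition ordered_basis :: "nat \<Rightarrow> (nat \<Rightarrow> 'a) \<Rightarrow> 'a set \<Rightarrow> bool" where
  "ordered_basis n b V \<longleftrightarrow> inj_on b {..<n} \<and> independent (b ` {..<n}) \<and> span (b ` {..<n}) = V"

definition coord :: "nat \<Rightarrow> (nat \<Rightarrow> 'a) \<Rightarrow> 'a \<Rightarrow> nat \<Rightarrow> complex" where
  "coord n b v i = representation (b ` {..<n}) v (b i)"

lemma finite_if_independent: "independent B \<Longrightarrow> finite B"
  using finite_dim independent_span_bound by (metis subset_UNIV)

lemma finite_basis:
  obtains C where "independent C" "span C = UNIV" "finite C"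
proof -
  obtain C where C: "C \<subseteq> UNIV" "independent C" "UNIV \<subseteq> span C" "card C = dim UNIV"
    by (rule basis_exists)
  then show thesis using finite_if_independent[OF C(2)] by (intro that[of C]) auto
qed

lemma ordered_basis_enumerate:
  assumes "independent B"
  obtains n b where "ordered_basis n b (span B)" "b ` {..<n} = B"
proof -
  obtain b n where "B = b ` {i::nat. i < n}" "inj_on b {i. i < n}"
    using finite_imp_nat_seg_image_inj_on[OF finite_if_independent[OF assms]] by blast
  then show thesis using assms by (intro that[of n b]) (auto simp: ordered_basis_def lessThan_def)
qed

lemma ordered_basis_exists:
  assumes "subspace V"
  obtains n b where "ordered_basis n b V"
proof -
  obtain B where B: "B \<subseteq> V" "independent B" "V \<subseteq> span B" by (rule basis_exists)
  then have "span B = V" using assms by (intro subset_antisym) (auto intro: span_minimal[THEN subsetD])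
  then show thesis using ordered_basis_enumerate[OF B(2)] that by metis
qed

lemma ordered_basis_mem: "ordered_basis n b V \<Longrightarrow> i < n \<Longrightarrow> b i \<in> V"
  by (auto simp: ordered_basis_def intro: span_base)

lemma ordered_basis_subspace: "ordered_basis n b V \<Longrightarrow> subspace V"
  by (auto simp: ordered_basis_def)

lemma coord_scale: "ordered_basis n b V \<Longrightarrow> v \<in> V \<Longrightarrow> coord n b (c *s v) i = c * coord n b v i"
  by (auto simp: ordered_basis_def coord_def representation_scale)

lemma coord_sum:
  "ordered_basis n b V \<Longrightarrow> (\<And>s. s \<in> S \<Longrightarrow> f s \<in> V) \<Longrightarrow> coord n b (sum f S) i = (\<Sum>s\<in>S. coord n b (f s) i)"
  by (auto simp: ordered_basis_def coord_def representation_sum)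

lemma coord_basis: "ordered_basis n b V \<Longrightarrow> i < n \<Longrightarrow> j < n \<Longrightarrow> coord n b (b j) i = (if i = j then 1 else 0)"
  by (auto simp: ordered_basis_def coord_def representation_basis inj_on_def)

lemma sum_coord:
  assumes "ordered_basis n b V" "v \<in> V"
  shows "(\<Sum>i<n. coord n b v i *s b i) = v"
proof -
  have "(\<Sum>i<n. coord n b v i *s b i)
      = (\<Sum>x\<in>b ` {..<n}. representation (b ` {..<n}) v x *s x)"
    using assms by (subst sum.reindex) (auto simp: ordered_basis_def coord_def)
  also have "\<dots> = v"
    using assms by (intro sum_representation_eq) (auto simp: ordered_basis_def)
  finally show ?thesis .
qed

lemma lincomb_mem: "ordered_basis n b V \<Longrightarrow> (\<Sum>i<n. c i *s b i) \<in> V"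
  by (intro subspace_sum) (auto intro: ordered_basis_subspace subspace_scale ordered_basis_mem)

lemma coord_lincomb:
  assumes "ordered_basis n b V" "i < n"
  shows "coord n b (\<Sum>j<n. c j *s b j) i = c i"
proof -
  have mem: "b j \<in> V" "c j *s b j \<in> V" if "j < n" for j
    using assms that ordered_basis_mem ordered_basis_subspace subspace_scale by blast+
  have "coord n b (\<Sum>j<n. c j *s b j) i = (\<Sum>j<n. coord n b (c j *s b j) i)"
    using mem by (intro coord_sum[OF assms(1)]) auto
  also have "\<dots> = (\<Sum>j<n. if i = j then c j else 0)"
    using mem by (intro sum.cong) (auto simp: coord_scale[OF assms(1)] coord_basis[OF assms])
  also have "\<dots> = c i" using assms(2) by simp
  finally show ?thesis .
qed

text \<open>Expansion of \<open>v\<close> in the basis \<open>b\<close>: the basic rule behind matrix products, base change and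
  bilinear expansion.\<close>

lemma coord_lin:
  assumes b: "ordered_basis n b V" and c: "ordered_basis m c W" and f: "lin f" "f ` V \<subseteq> W" and v: "v \<in> V"
  shows "coord m c (f v) i = (\<Sum>j<n. coord m c (f (b j)) i * coord n b v j)"
proof -
  have mem: "f (b j) \<in> W" "coord n b v j *s f (b j) \<in> W" if "j < n" for j
    using f(2) ordered_basis_mem[OF b that] ordered_basis_subspace[OF c] subspace_scale by blast+
  have "f v = (\<Sum>j<n. coord n b v j *s f (b j))"
    by (subst sum_coord[OF b v, symmetric]) (simp add: lin_sum[OF f(1)] lin_scale[OF f(1)])
  then have "coord m c (f v) i = coord m c (\<Sum>j<n. coord n b v j *s f (b j)) i" by simp
  then show ?thesis using mem
    by (subst (asm) coord_sum[OF c]) (auto simp: coord_scale[OF c] mult.commute)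
qed

text \<open>Expand the vectors of \<open>b\<close> in the basis \<open>c\<close>, exchange the two sums and contract the expansion
  of \<open>f (c j)\<close> in the basis \<open>b\<close>.\<close>

lemma trace_basis_independent:
  assumes b: "ordered_basis n b V" and c: "ordered_basis m c V" and f: "lin f" "f ` V \<subseteq> V"
  shows "(\<Sum>i<n. coord n b (f (b i)) i) = (\<Sum>j<m. coord m c (f (c j)) j)"
proof -
  have "(\<Sum>i<n. coord n b (f (b i)) i) = (\<Sum>i<n. \<Sum>j<m. coord n b (f (c j)) i * coord m c (b i) j)"
    using ordered_basis_mem[OF b] by (intro sum.cong refl coord_lin[OF c b f]) auto
  also have "\<dots> = (\<Sum>j<m. \<Sum>i<n. coord m c (b i) j * coord n b (f (c j)) i)"
    by (subst sum.swap) (simp add: mult.commute)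
  also have "\<dots> = (\<Sum>j<m. coord m c (f (c j)) j)"
  proof (rule sum.cong[OF refl])
    fix j assume "j \<in> {..<m}"
    then have "f (c j) \<in> V" using f(2) ordered_basis_mem[OF c] by auto
    from coord_lin[OF b c module_hom_ident _ this]
    show "(\<Sum>i<n. coord m c (b i) j * coord n b (f (c j)) i) = coord m c (f (c j)) j"
      by simp
  qed
  finally show ?thesis .
qed

lemma trace_on_ordered_basis:
  assumes b: "ordered_basis n b V" and f: "lin f" "f ` V \<subseteq> V"
  shows "trace_on V f = (\<Sum>i<n. coord n b (f (b i)) i)"
proof -
  define B where "B = (SOME B. independent B \<and> span B = V)"
  have "independent B \<and> span B = V"
    unfolding B_def by (rule someI[of _ "b ` {..<n}"]) (use b in \<open>auto simp: ordered_basis_def\<close>)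
  then obtain m c where c: "ordered_basis m c V" "c ` {..<m} = B"
    using ordered_basis_enumerate by metis
  have "trace_on V f = (\<Sum>x\<in>c ` {..<m}. representation (c ` {..<m}) (f x) x)"
    unfolding trace_on_def Let_def c(2) B_def ..
  also have "\<dots> = (\<Sum>j<m. coord m c (f (c j)) j)"
    using c(1) by (subst sum.reindex) (auto simp: ordered_basis_def coord_def)
  finally show ?thesis using trace_basis_independent[OF b c(1) f] by simp
qed

lemma ordered_basis_image:
  assumes b: "ordered_basis n b V" and \<phi>: "lin \<phi>" "inj_on \<phi> V"
  shows "ordered_basis n (\<lambda>i. \<phi> (b i)) (\<phi> ` V)"
proof -
  have bV: "span (b ` {..<n}) = V" and ind: "independent (b ` {..<n})" and inj: "inj_on b {..<n}"
    using b by (auto simp: ordered_basis_def)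
  have "independent (\<phi> ` b ` {..<n})"
    by (rule pair.linear_independent_injective_image[OF \<phi>(1) ind]) (simp add: bV \<phi>(2))
  moreover have "span (\<phi> ` b ` {..<n}) = \<phi> ` V"
    using pair.linear_span_image[OF \<phi>(1)] bV by simp
  moreover have "inj_on (\<lambda>i. \<phi> (b i)) {..<n}"
    using inj \<phi>(2) ordered_basis_mem[OF b] by (auto simp: inj_on_def)
  ultimately show ?thesis by (simp add: ordered_basis_def image_image)
qed

text \<open>The images of a basis under \<open>\<phi>\<close> form a basis with respect to which \<open>f'\<close> has the matrix of \<open>f\<close>.
  This is what makes characters of isomorphic submodules equal, also when \<open>\<phi>\<close> intertwines the
  actions of two conjugate groups.\<close>

lemma trace_on_isomorphic:
  assumes V: "subspace V" and \<phi>: "lin \<phi>" "inj_on \<phi> V"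
    and f: "lin f" "f ` V \<subseteq> V" and f': "lin f'" and int: "\<And>v. v \<in> V \<Longrightarrow> f' (\<phi> v) = \<phi> (f v)"
  shows "trace_on (\<phi> ` V) f' = trace_on V f"
proof -
  obtain n b where b: "ordered_basis n b V" using ordered_basis_exists[OF V] .
  note \<phi>b = ordered_basis_image[OF b \<phi>]
  have f'V: "f' ` \<phi> ` V \<subseteq> \<phi> ` V" using int f(2) by auto
  have "coord n (\<lambda>i. \<phi> (b i)) (f' (\<phi> (b i))) i = coord n b (f (b i)) i" if i: "i < n" for i
  proof -
    have "f (b i) \<in> V" using f(2) ordered_basis_mem[OF b i] by auto
    then have "\<phi> (f (b i)) = (\<Sum>j<n. coord n b (f (b i)) j *s \<phi> (b j))"
      by (subst sum_coord[OF b, symmetric]) (simp_all add: lin_sum[OF \<phi>(1)] lin_scale[OF \<phi>(1)])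
    then show ?thesis
      using coord_lincomb[OF \<phi>b i] int[OF ordered_basis_mem[OF b i]] by simp
  qed
  then show ?thesis
    by (simp add: trace_on_ordered_basis[OF \<phi>b f' f'V] trace_on_ordered_basis[OF b f])
qed

section \<open>Schur's lemma\<close>

text \<open>Commutation is required on the whole algebra, not just on a submodule. This saves restricting maps
  and holds for equivariant projections and for multiplication by a vector that \<open>H\<close> fixes.\<close>

definition equivariant :: "('a \<Rightarrow> 'a) set \<Rightarrow> ('a \<Rightarrow> 'a) \<Rightarrow> bool" where
  "equivariant H f \<longleftrightarrow> lin f \<and> (\<forall>h\<in>H. \<forall>v. f (h v) = h (f v))"

lemma equivariant_image_invariant:
  assumes "equivariant H f" "invariant_subspace H W"
  shows "invariant_subspace H (f ` W)"
  using assms by (auto simp: equivariant_def invariant_subspace_def image_subset_iff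
      intro!: pair.linear_subspace_image) (metis imageI)

lemma equivariant_kernel_invariant:
  assumes H: "\<forall>h\<in>H. lin h" and "equivariant H f" "invariant_subspace H W"
  shows "invariant_subspace H {w\<in>W. f w = 0}"
proof -
  have f: "lin f" using assms(2) by (simp add: equivariant_def)
  have "subspace {w\<in>W. f w = 0}"
    using assms(3) f by (auto simp: invariant_subspace_def subspace_def lin_add lin_scale lin_zero)
  moreover have "h ` {w\<in>W. f w = 0} \<subseteq> {w\<in>W. f w = 0}" if "h \<in> H" for h
    using assms that by (auto simp: equivariant_def invariant_subspace_def lin_zero image_subset_iff)
  ultimately show ?thesis by (simp add: invariant_subspace_def)
qed

text \<open>The kernel of \<open>f\<close> in \<open>W\<close> and the image of \<open>W\<close> are invariant, and neither can be the trivial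
  subspace that would make \<open>f\<close> vanish on \<open>W\<close>.\<close>

lemma schur_isomorphism:
  assumes H: "\<forall>h\<in>H. lin h"
    and W: "irreducible_submodule H W" and V: "irreducible_submodule H V"
    and f: "equivariant H f" "f ` W \<subseteq> V" and nz: "w \<in> W" "f w \<noteq> 0"
  shows "inj_on f W" "f ` W = V"
proof -
  have lin: "lin f" using f by (simp add: equivariant_def)
  have Wi: "invariant_subspace H W" and Ws: "subspace W"
    using W by (auto simp: irreducible_submodule_def invariant_subspace_def)
  have "{w\<in>W. f w = 0} = {0}"
    using W equivariant_kernel_invariant[OF H f(1) Wi] nz unfolding irreducible_submodule_def by blast
  then show "inj_on f W"
    using Ws by (auto simp: inj_on_def lin_diff[OF lin] dest!: subspace_diff) (metis (mono_tags, lifting)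
        Ws lin_diff[OF lin] mem_Collect_eq right_minus_eq singletonD subspace_diff)
  show "f ` W = V"
    using V equivariant_image_invariant[OF f(1) Wi] f(2) nz unfolding irreducible_submodule_def by blast
qed

lemma submodule_char_image:
  assumes H: "\<forall>h\<in>H. lin h" and W: "invariant_subspace H W" and f: "equivariant H f" "inj_on f W"
  shows "submodule_char H (f ` W) = submodule_char H W"
  unfolding submodule_char_def
proof (rule restrict_ext)
  fix h assume "h \<in> H"
  then show "trace_on (f ` W) h = trace_on W h"
    using assms by (intro trace_on_isomorphic) (auto simp: equivariant_def invariant_subspace_def)
qed

definition rep_mat :: "nat \<Rightarrow> (nat \<Rightarrow> 'a) \<Rightarrow> ('a \<Rightarrow> 'a) \<Rightarrow> complex mat" where
  "rep_mat n b f = mat n n (\<lambda>(i, j). coord n b (f (b j)) i)"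

definition lincomb :: "nat \<Rightarrow> (nat \<Rightarrow> 'a) \<Rightarrow> complex vec \<Rightarrow> 'a" where
  "lincomb n b u = (\<Sum>i<n. u $ i *s b i)"

lemma rep_mat_carrier [simp]: "rep_mat n b f \<in> carrier_mat n n"
  by (simp add: rep_mat_def)

lemma lincomb_in: "ordered_basis n b V \<Longrightarrow> lincomb n b u \<in> V"
  unfolding lincomb_def by (rule lincomb_mem)

lemma coord_lincomb_vec: "ordered_basis n b V \<Longrightarrow> i < n \<Longrightarrow> coord n b (lincomb n b u) i = u $ i"
  unfolding lincomb_def by (rule coord_lincomb)

lemma lincomb_add: "u \<in> carrier_vec n \<Longrightarrow> v \<in> carrier_vec n \<Longrightarrow> lincomb n b (u + v) = lincomb n b u + lincomb n b v"
  by (simp add: lincomb_def scale_left_distrib sum.distrib)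

lemma lincomb_scale: "u \<in> carrier_vec n \<Longrightarrow> lincomb n b (c \<cdot>\<^sub>v u) = c *s lincomb n b u"
  by (simp add: lincomb_def scale_sum_right)

lemma lincomb_zero: "lincomb n b (0\<^sub>v n) = 0"
  by (simp add: lincomb_def)

lemma lincomb_inject:
  assumes "ordered_basis n b V" "u \<in> carrier_vec n" "v \<in> carrier_vec n" "lincomb n b u = lincomb n b v"
  shows "u = v"
proof (rule eq_vecI)
  fix i assume "i < dim_vec v"
  then show "u $ i = v $ i"
    using assms coord_lincomb_vec[OF assms(1), of i] by (metis carrier_vecD)
qed (use assms in auto)

lemma lincomb_coord:
  "ordered_basis n b V \<Longrightarrow> v \<in> V \<Longrightarrow> lincomb n b (vec n (coord n b v)) = v"
  using sum_coord by (simp add: lincomb_def)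

lemma lin_lincomb:
  assumes b: "ordered_basis n b V" and f: "lin f" "f ` V \<subseteq> V" and u: "u \<in> carrier_vec n"
  shows "f (lincomb n b u) = lincomb n b (rep_mat n b f *\<^sub>v u)"
proof -
  have V: "lincomb n b u \<in> V" by (rule lincomb_in[OF b])
  have "coord n b (f (lincomb n b u)) i = (rep_mat n b f *\<^sub>v u) $ i" if "i < n" for i
    using that u coord_lincomb_vec[OF b]
    by (auto simp: coord_lin[OF b b f V] rep_mat_def scalar_prod_def lessThan_atLeast0 intro!: sum.cong)
  moreover have "f (lincomb n b u) \<in> V" using f V by auto
  ultimately show ?thesis
    using sum_coord[OF b, of "f (lincomb n b u)"] by (simp add: lincomb_def)
qed

text \<open>Over the complex numbers the matrix of \<open>f\<close> on \<open>V\<close> has an eigenvalue; its eigenspace in \<open>V\<close> is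
  invariant and nonzero, hence all of \<open>V\<close>.\<close>

lemma schur_scalar:
  assumes H: "\<forall>h\<in>H. lin h" and V: "irreducible_submodule H V"
    and f: "equivariant H f" "f ` V \<subseteq> V"
  shows "\<exists>c. \<forall>v\<in>V. f v = c *s v"
proof -
  have Vi: "invariant_subspace H V" and Vs: "subspace V" and nz: "V \<noteq> {0}"
    using V by (auto simp: irreducible_submodule_def invariant_subspace_def)
  have lin: "lin f" using f by (simp add: equivariant_def)
  obtain n b where b: "ordered_basis n b V" using ordered_basis_exists[OF Vs] .
  have "n \<noteq> 0" using b nz by (auto simp: ordered_basis_def)
  then have "spectrum (rep_mat n b f) \<noteq> {}" by (intro spectrum_non_empty[of _ n]) auto
  then obtain c u where "eigenvector (rep_mat n b f) u c"
    by (auto simp: spectrum_def eigenvalue_def)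
  then have u: "u \<in> carrier_vec n" "u \<noteq> 0\<^sub>v n" "rep_mat n b f *\<^sub>v u = c \<cdot>\<^sub>v u"
    by (auto simp: eigenvector_def rep_mat_def)
  define w where "w = lincomb n b u"
  have w: "w \<in> V" "w \<noteq> 0" "f w = c *s w"
    using lincomb_in[OF b] lincomb_inject[OF b u(1), of "0\<^sub>v n"] u lin_lincomb[OF b lin f(2) u(1)]
    by (auto simp: w_def lincomb_zero lincomb_scale)
  \<comment> \<open>The eigenspace is the kernel of an equivariant map, hence invariant.\<close>
  have eq: "equivariant H (\<lambda>v. f v - c *s v)"
    unfolding equivariant_def
  proof (intro conjI ballI allI)
    show "lin (\<lambda>v. f v - c *s v)"
      by (rule linI) (simp_all add: lin_add[OF lin] lin_scale[OF lin] scale_right_distrib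
          scale_right_diff_distrib mult.commute)
    fix h v assume "h \<in> H"
    then have "lin h" "f (h v) = h (f v)" using H f(1) by (auto simp: equivariant_def)
    then show "f (h v) - c *s h v = h (f v - c *s v)" by (simp add: lin_diff lin_scale)
  qed
  have "{v\<in>V. f v - c *s v = 0} = V"
    using V equivariant_kernel_invariant[OF H eq Vi] w unfolding irreducible_submodule_def by auto
  then show ?thesis by auto
qed

section \<open>Uniqueness of the isotypic components\<close>

lemma sum_space_iff:
  fixes n :: nat
  assumes V: "direct_sum_decomposition {..<n} V" and P: "projections {..<n} V P" and S: "S \<subseteq> {..<n}"
  shows "v \<in> sum_space S V \<longleftrightarrow> (\<forall>i<n. i \<notin> S \<longrightarrow> P i v = 0)"
proof
  assume v: "v \<in> sum_space S V"
  show "\<forall>i<n. i \<notin> S \<longrightarrow> P i v = 0"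
  proof (intro allI impI)
    fix i assume i: "i < n" "i \<notin> S"
    have "(\<Union>j\<in>S. V j) \<subseteq> {v. P i v = 0}"
    proof (rule UN_least, rule subsetI)
      fix j w assume j: "j \<in> S" "w \<in> V j"
      then show "w \<in> {v. P i v = 0}"
        using projectionsD(4)[OF P, of i j w] i S by auto
    qed
    moreover have "subspace {v. P i v = 0}"
      using projectionsD(1)[OF P] i by (intro pair.linear_subspace_kernel) auto
    ultimately show "P i v = 0" using v span_minimal unfolding sum_space_def by blast
  qed
next
  assume *: "\<forall>i<n. i \<notin> S \<longrightarrow> P i v = 0"
  have "v = (\<Sum>i<n. P i v)" using projections_lessThan_sum[OF P] by simp
  also have "\<dots> = (\<Sum>i\<in>S. P i v)" using * S by (intro sum.mono_neutral_right) auto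
  also have "\<dots> \<in> sum_space S V"
    using projectionsD(2)[OF P] S unfolding sum_space_def by (intro span_sum span_base) blast
  finally show "v \<in> sum_space S V" .
qed

text \<open>Summands with the same label are merged by adding their projections. The labels may come
  from a larger, possibly infinite set; a label that does not occur gets the zero space.\<close>

lemma direct_sum_decomposition_group:
  fixes n :: nat
  assumes V: "direct_sum_decomposition {..<n} V" and c: "\<And>i. i < n \<Longrightarrow> c i \<in> X"
  shows "direct_sum_decomposition X (\<lambda>x. sum_space {i. i < n \<and> c i = x} V)"
proof -
  obtain P where P: "projections {..<n} V P" by (rule direct_sum_decompositionE[OF V])
  have PV: "P i v \<in> V i" and lin: "lin (P i)" and kill: "j < n \<Longrightarrow> i \<noteq> j \<Longrightarrow> P j (P i v) = 0"
    and idem: "P i (P i v) = P i v" if "i < n" for i j v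
    using projectionsD[OF P, of i] projectionsD[OF P, of j] that by simp_all
  define Q where "Q x v = (\<Sum>i | i < n \<and> c i = x. P i v)" for x v
  have iff: "v \<in> sum_space {i. i < n \<and> c i = x} V \<longleftrightarrow> (\<forall>i<n. c i \<noteq> x \<longrightarrow> P i v = 0)" for v x
    by (subst sum_space_iff[OF V P]) auto
  have PQ: "P j (Q x v) = (if c j = x then P j v else 0)" if "j < n" for j x v
  proof -
    have "P j (Q x v) = (\<Sum>i | i < n \<and> c i = x. P j (P i v))"
      unfolding Q_def by (rule lin_sum[OF lin[OF that]])
    also have "\<dots> = (\<Sum>i | i < n \<and> c i = x. if i = j then P j v else 0)"
      using that kill idem by (intro sum.cong) auto
    also have "\<dots> = (if c j = x then P j v else 0)" using that by simp
    finally show ?thesis .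
  qed
  have Q_out: "Q x v = 0" if "x \<notin> c ` {..<n}" for x v
    unfolding Q_def using that by (intro sum.neutral) auto
  show ?thesis
  proof (rule direct_sum_decompositionI)
    show "projections X (\<lambda>x. sum_space {i. i < n \<and> c i = x} V) Q"
      unfolding projections_def
    proof (intro conjI ballI allI impI)
      fix x show "lin (Q x)" unfolding Q_def by (intro lin_sum_maps lin) auto
    next
      fix x v show "Q x v \<in> sum_space {i. i < n \<and> c i = x} V" by (simp add: iff PQ)
    next
      fix x v assume "v \<in> sum_space {i. i < n \<and> c i = x} V"
      then have "\<forall>i<n. c i \<noteq> x \<longrightarrow> P i v = 0" by (simp add: iff)
      then have "(\<Sum>i<n. P i v) = Q x v" unfolding Q_def by (intro sum.mono_neutral_right) auto
      then show "Q x v = v" by (simp add: projections_lessThan_sum[OF P])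
    next
      fix x y v assume "x \<noteq> y" "v \<in> sum_space {i. i < n \<and> c i = x} V"
      then show "Q y v = 0" unfolding Q_def iff by (intro sum.neutral) auto
    next
      fix v
      have sub: "{x\<in>X. Q x v \<noteq> 0} \<subseteq> c ` {..<n}" using Q_out by blast
      then show "finite {x\<in>X. Q x v \<noteq> 0}" by (rule finite_subset) simp
      have "v = (\<Sum>i<n. P i v)" by (simp add: projections_lessThan_sum[OF P])
      also have "\<dots> = (\<Sum>x\<in>c ` {..<n}. Q x v)"
        using sum.image_gen[of "{..<n}" "\<lambda>i. P i v" c] by (simp add: Q_def)
      also have "\<dots> = (\<Sum>x\<in>{x\<in>X. Q x v \<noteq> 0}. Q x v)"
        by (rule sum.mono_neutral_right) (use sub c in auto)
      finally show "v = (\<Sum>x\<in>{x\<in>X. Q x v \<noteq> 0}. Q x v)" .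
    qed
  qed (simp add: sum_space_def)
qed

text \<open>Applying \<open>h\<close> to the components of \<open>v\<close> gives the components of \<open>h v\<close>, because every summand
  is invariant.\<close>

lemma projection_equivariant:
  assumes H: "\<forall>h\<in>H. lin h" and V: "irreducible_decomposition H n V" and P: "projections {..<n} V P"
    and i: "i < n"
  shows "equivariant H (P i)"
  unfolding equivariant_def
proof (intro conjI ballI allI)
  have lin: "lin (P i)" and PV: "\<And>j v. j < n \<Longrightarrow> P j v \<in> V j"
    and kill: "\<And>j v. j < n \<Longrightarrow> j \<noteq> i \<Longrightarrow> v \<in> V j \<Longrightarrow> P i v = 0" and fixed: "\<And>v. v \<in> V i \<Longrightarrow> P i v = v"
    using projectionsD[OF P] i by simp_all
  show "lin (P i)" by (rule lin)
  fix h v assume h: "h \<in> H"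
  have hV: "h (P j v) \<in> V j" if "j < n" for j
  proof -
    have "invariant_subspace H (V j)"
      using V that by (simp add: irreducible_decomposition_def irreducible_submodule_def)
    then show ?thesis using PV[OF that] h by (auto simp: invariant_subspace_def)
  qed
  have hlin: "lin h" using H h by blast
  have "P i (h v) = P i (h (\<Sum>j<n. P j v))" by (simp add: projections_lessThan_sum[OF P])
  also have "\<dots> = (\<Sum>j<n. P i (h (P j v)))" by (simp add: lin_sum[OF hlin] lin_sum[OF lin])
  also have "\<dots> = (\<Sum>j<n. if j = i then h (P i v) else 0)"
    using hV kill fixed by (intro sum.cong) auto
  also have "\<dots> = h (P i v)" using i by simp
  finally show "P i (h v) = h (P i v)" .
qed

text \<open>If \<open>P i\<close> does not vanish on \<open>W\<close>, Schur's lemma makes it an isomorphism of \<open>W\<close> with \<open>V i\<close>, so the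
  two have the same character. All other components of a vector of \<open>W\<close> are zero.\<close>

lemma irreducible_in_isotypic:
  assumes H: "\<forall>h\<in>H. lin h" and V: "irreducible_decomposition H n V" and W: "irreducible_submodule H W"
  shows "W \<subseteq> sum_space {i. i < n \<and> submodule_char H (V i) = submodule_char H W} V"
proof
  fix w assume w: "w \<in> W"
  have ds: "direct_sum_decomposition {..<n} V" and irr: "\<And>i. i < n \<Longrightarrow> irreducible_submodule H (V i)"
    using V by (auto simp: irreducible_decomposition_def)
  obtain P where P: "projections {..<n} V P" by (rule direct_sum_decompositionE[OF ds])
  have "submodule_char H (V i) = submodule_char H W" if i: "i < n" "P i w \<noteq> 0" for i
  proof -
    note eq = projection_equivariant[OF H V P i(1)]
    have "P i ` W \<subseteq> V i" using projectionsD(2)[OF P] i by auto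
    from schur_isomorphism[OF H W irr[OF i(1)] eq this w i(2)]
    show ?thesis
      using submodule_char_image[OF H _ eq] W by (metis irreducible_submodule_def)
  qed
  then show "w \<in> sum_space {i. i < n \<and> submodule_char H (V i) = submodule_char H W} V"
    by (subst sum_space_iff[OF ds P]) auto
qed

text \<open>Each summand of one decomposition is contained in the component of its character for the other,
  and the roles can be exchanged.\<close>

lemma is_isotypic_unique:
  assumes H: "\<forall>h\<in>H. lin h" and D: "is_isotypic H D" and E: "is_isotypic H E"
  shows "D = E"
proof -
  have "D \<chi> \<subseteq> E \<chi>" if D: "is_isotypic H D" and E: "is_isotypic H E" for D E \<chi>
  proof -
    from D obtain n V where V: "irreducible_decomposition H n V"
      and D: "D \<chi> = sum_space {i. i < n \<and> submodule_char H (V i) = \<chi>} V" unfolding is_isotypic_def by blast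
    from E obtain m W where W: "irreducible_decomposition H m W"
      and E: "E \<chi> = sum_space {i. i < m \<and> submodule_char H (W i) = \<chi>} W" unfolding is_isotypic_def by blast
    have "V i \<subseteq> E \<chi>" if "i < n" "submodule_char H (V i) = \<chi>" for i
      using irreducible_in_isotypic[OF H W, of "V i"] V that unfolding E irreducible_decomposition_def by auto
    then show ?thesis unfolding D
      unfolding sum_space_def[of "{i. i < n \<and> submodule_char H (V i) = \<chi>}"]
      by (intro span_minimal) (auto simp: E sum_space_def)
  qed
  then show ?thesis using D E by (intro ext) blast
qed

lemma isotypic_eq:
  assumes "\<forall>h\<in>H. lin h" "is_isotypic H D"
  shows "isotypic H = D"
  unfolding isotypic_def using assms is_isotypic_unique by (intro the_equality) blast+

lemma isotypic_of_decomposition: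
  assumes "\<forall>h\<in>H. lin h" "irreducible_decomposition H n V"
  shows "isotypic H \<chi> = sum_space {i. i < n \<and> submodule_char H (V i) = \<chi>} V"
proof -
  have "is_isotypic H (\<lambda>\<chi>. sum_space {i. i < n \<and> submodule_char H (V i) = \<chi>} V)"
    using assms(2) unfolding is_isotypic_def by blast
  from isotypic_eq[OF assms(1) this] show ?thesis by simp
qed

section \<open>The automorphism group and transport of structure\<close>

lemma mul_sum_left: "sum f S \<cdot> c = (\<Sum>s\<in>S. f s \<cdot> c)"
  and mul_sum_right: "c \<cdot> sum f S = (\<Sum>s\<in>S. c \<cdot> f s)"
  by (rule lin_sum[OF linear_left], rule lin_sum[OF linear_right])

lemma Aut_memD:
  assumes "f \<in> carrier Aut"
  shows "lin f" "bij f" "f (a \<cdot> b) = f a \<cdot> f b"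
  using assms by (auto simp: Aut_def)

lemma Aut_mult [simp]: "f \<otimes>\<^bsub>Aut\<^esub> g = f \<circ> g"
  and Aut_one [simp]: "\<one>\<^bsub>Aut\<^esub> = id"
  by (simp_all add: Aut_def)

lemma group_Aut: "group Aut"
proof (rule groupI)
  fix f g assume "f \<in> carrier Aut" "g \<in> carrier Aut"
  then show "f \<otimes>\<^bsub>Aut\<^esub> g \<in> carrier Aut"
    using bij_comp[of g f] by (auto simp: Aut_def o_def intro: lin_compose)
next
  show "\<one>\<^bsub>Aut\<^esub> \<in> carrier Aut" by (auto simp: Aut_def intro: linI)
next
  fix f assume f: "f \<in> carrier Aut"
  note fD = Aut_memD[OF f]
  have inj: "inj f" using fD(2) by (rule bij_is_inj)
  have inv: "f (inv_into UNIV f v) = v" for v using fD(2) by (simp add: bij_is_surj surj_f_inv_f)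
  have "lin (inv_into UNIV f)"
    by (rule linI) (rule injD[OF inj], simp add: inv lin_add[OF fD(1)] lin_scale[OF fD(1)])+
  moreover have "inv_into UNIV f (a \<cdot> b) = inv_into UNIV f a \<cdot> inv_into UNIV f b" for a b
    by (rule injD[OF inj]) (simp add: inv fD(3))
  ultimately have "inv_into UNIV f \<in> carrier Aut"
    using fD(2) by (simp add: Aut_def bij_imp_bij_inv)
  moreover have "inv_into UNIV f \<otimes>\<^bsub>Aut\<^esub> f = \<one>\<^bsub>Aut\<^esub>" using inj by simp
  ultimately show "\<exists>g\<in>carrier Aut. g \<otimes>\<^bsub>Aut\<^esub> f = \<one>\<^bsub>Aut\<^esub>" by blast
qed (auto simp: o_assoc)

lemma inv_Aut:
  assumes "f \<in> carrier Aut"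
  shows "inv\<^bsub>Aut\<^esub> f \<in> carrier Aut" "f ((inv\<^bsub>Aut\<^esub> f) v) = v" "(inv\<^bsub>Aut\<^esub> f) (f v) = v"
  using group.inv_closed[OF group_Aut assms] fun_cong[OF group.r_inv[OF group_Aut assms], of v]
    fun_cong[OF group.l_inv[OF group_Aut assms], of v] by (simp_all)

lemma subspace_sum_space: "subspace (sum_space X D)"
  by (simp add: sum_space_def)

lemma sum_space_memI: "x \<in> X \<Longrightarrow> v \<in> D x \<Longrightarrow> v \<in> sum_space X D"
  unfolding sum_space_def by (rule span_base) blast

lemma sum_space_image: "lin f \<Longrightarrow> sum_space X (\<lambda>x. f ` D x) = f ` sum_space X D"
  unfolding sum_space_def by (simp only: pair.linear_span_image[symmetric] image_UN)

lemma direct_sum_decomposition_image: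
  assumes f: "f \<in> carrier Aut" and D: "direct_sum_decomposition X D"
  shows "direct_sum_decomposition X (\<lambda>x. f ` D x)"
proof -
  have lin: "lin f" by (rule Aut_memD(1)[OF f])
  define k where "k = inv\<^bsub>Aut\<^esub> f"
  have fk: "f (k v) = v" and kf: "k (f v) = v" and klin: "lin k" for v
    using inv_Aut[OF f] Aut_memD(1) by (auto simp: k_def)
  have f0: "f v = 0 \<longleftrightarrow> v = 0" for v using kf lin_zero[OF lin] lin_zero[OF klin] by metis
  obtain P where P: "projections X D P" by (rule direct_sum_decompositionE[OF D])
  show ?thesis
  proof (rule direct_sum_decompositionI)
    show "subspace (f ` D x)" if "x \<in> X" for x
      using D that lin by (auto simp: direct_sum_decomposition_def intro: pair.linear_subspace_image)
    show "projections X (\<lambda>x. f ` D x) (\<lambda>x v. f (P x (k v)))"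
      unfolding projections_def
    proof (intro conjI ballI allI impI)
      fix x assume "x \<in> X"
      then show "lin (\<lambda>v. f (P x (k v)))"
        using lin_compose[OF lin lin_compose[OF projectionsD(1)[OF P] klin]] by blast
    next
      fix x v assume "x \<in> X"
      then show "f (P x (k v)) \<in> f ` D x" using projectionsD(2)[OF P] by blast
    next
      fix x v assume "x \<in> X" "v \<in> f ` D x"
      then show "f (P x (k v)) = v" using projectionsD(3)[OF P] kf by auto
    next
      fix x y v assume "x \<in> X" "y \<in> X" "x \<noteq> y" "v \<in> f ` D x"
      then show "f (P y (k v)) = 0" using projectionsD(4)[OF P] kf lin_zero[OF lin] by auto
    next
      fix v
      have "finite {x\<in>X. P x (k v) \<noteq> 0}" and kv: "k v = (\<Sum>x\<in>{x\<in>X. P x (k v) \<noteq> 0}. P x (k v))"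
        using P unfolding projections_def by blast+
      then show "finite {x\<in>X. f (P x (k v)) \<noteq> 0}" by (simp add: f0)
      have "v = f (\<Sum>x\<in>{x\<in>X. P x (k v) \<noteq> 0}. P x (k v))" using kv fk by metis
      then show "v = (\<Sum>x\<in>{x\<in>X. f (P x (k v)) \<noteq> 0}. f (P x (k v)))"
        by (simp add: f0 lin_sum[OF lin])
    qed
  qed
qed

lemma fusion_decomposition_image:
  assumes f: "f \<in> carrier Aut" and D: "fusion_decomposition \<Phi> D"
  shows "fusion_decomposition \<Phi> (\<lambda>x. f ` D x)"
proof -
  have "f a \<cdot> f b \<in> sum_space (snd \<Phi> x y) (\<lambda>x. f ` D x)"
    if "x \<in> fst \<Phi>" "y \<in> fst \<Phi>" "a \<in> D x" "b \<in> D y" for x y a b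
  proof -
    have "a \<cdot> b \<in> sum_space (snd \<Phi> x y) D" using D that by (auto simp: fusion_decomposition_def)
    then show ?thesis
      unfolding sum_space_image[OF Aut_memD(1)[OF f]] Aut_memD(3)[OF f, symmetric] by (rule imageI)
  qed
  then show ?thesis
    using D direct_sum_decomposition_image[OF f] by (auto simp: fusion_decomposition_def)
qed

lemma axis_image:
  assumes f: "f \<in> carrier Aut" and a: "axis \<Phi> e D a"
  shows "axis \<Phi> e (\<lambda>x. f ` D x) (f a)"
proof -
  have "f a \<noteq> 0"
    using a inv_Aut(3)[OF f, of a] lin_zero[OF Aut_memD(1)[OF inv_Aut(1)[OF f]]] by (auto simp: axis_def)
  moreover have "f a \<cdot> f b = c *s f b" if "a \<cdot> b = c *s b" for b c
    using Aut_memD(3)[OF f, of a b] that by (simp add: lin_scale[OF Aut_memD(1)[OF f]])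
  ultimately show ?thesis using a unfolding axis_def by blast
qed

lemma fusion_decomposition_cong:
  assumes \<Phi>: "is_fusion_law \<Phi>" and eq: "\<And>x. x \<in> fst \<Phi> \<Longrightarrow> D x = E x" and D: "fusion_decomposition \<Phi> D"
  shows "fusion_decomposition \<Phi> E"
proof -
  have "(if x \<in> fst \<Phi> then D x else {0}) = (if x \<in> fst \<Phi> then E x else {0})" for x
    using eq by simp
  then have "direct_sum_decomposition (fst \<Phi>) D = direct_sum_decomposition (fst \<Phi>) E"
    using eq by (simp add: direct_sum_decomposition_def)
  moreover have "sum_space (snd \<Phi> x y) D = sum_space (snd \<Phi> x y) E" if "x \<in> fst \<Phi>" "y \<in> fst \<Phi>" for x y
  proof -
    have "(\<Union>z\<in>snd \<Phi> x y. D z) = (\<Union>z\<in>snd \<Phi> x y. E z)"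
    proof (rule SUP_cong[OF refl])
      fix z assume "z \<in> snd \<Phi> x y"
      then show "D z = E z" using \<Phi> that by (intro eq) (auto simp: is_fusion_law_def)
    qed
    then show ?thesis by (simp add: sum_space_def)
  qed
  ultimately show ?thesis using D eq by (simp add: fusion_decomposition_def)
qed

text \<open>An \<open>f H f\<^sup>-\<^sup>1\<close>-invariant subspace of \<open>f V\<close> is pulled back by \<open>f\<^sup>-\<^sup>1\<close> to an \<open>H\<close>-invariant
  subspace of \<open>V\<close>.\<close>

lemma irreducible_submodule_conj:
  assumes f: "f \<in> carrier Aut" and V: "irreducible_submodule H V"
  shows "irreducible_submodule (conj_subgroup Aut f H) (f ` V)"
proof -
  define k where "k = inv\<^bsub>Aut\<^esub> f"
  have lin: "lin f" by (rule Aut_memD(1)[OF f])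
  have fk: "f (k v) = v" and kf: "k (f v) = v" and klin: "lin k" for v
    using inv_Aut[OF f] Aut_memD(1) by (auto simp: k_def)
  have K: "conj_subgroup Aut f H = (\<lambda>h v. f (h (k v))) ` H"
    by (auto simp: conj_subgroup_def k_def o_def)
  have fkW: "f ` k ` W = W" and kfW: "k ` f ` W = W" for W by (auto simp: image_image fk kf)
  have Vi: "subspace V" "\<And>h. h \<in> H \<Longrightarrow> h ` V \<subseteq> V" "V \<noteq> {0}"
    and min: "\<And>W. invariant_subspace H W \<Longrightarrow> W \<subseteq> V \<Longrightarrow> W = {0} \<or> W = V"
    using V by (auto simp: irreducible_submodule_def invariant_subspace_def)
  show ?thesis
    unfolding irreducible_submodule_def
  proof (intro conjI allI impI)
    show "invariant_subspace (conj_subgroup Aut f H) (f ` V)"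
      using Vi lin by (auto simp: invariant_subspace_def K kf image_subset_iff intro: pair.linear_subspace_image)
    show "f ` V \<noteq> {0}"
      using Vi(3) kfW[of V] lin_zero[OF klin] by auto
    fix W assume W: "invariant_subspace (conj_subgroup Aut f H) W \<and> W \<subseteq> f ` V"
    have "invariant_subspace H (k ` W)"
      unfolding invariant_subspace_def
    proof (intro conjI ballI)
      show "subspace (k ` W)" using W klin by (auto simp: invariant_subspace_def intro: pair.linear_subspace_image)
      fix h assume h: "h \<in> H"
      show "h ` k ` W \<subseteq> k ` W"
      proof clarify
        fix w assume "w \<in> W"
        then have "f (h (k w)) \<in> W" using W h by (auto simp: invariant_subspace_def K)
        then have "k (f (h (k w))) \<in> k ` W" by (rule imageI)
        then show "h (k w) \<in> k ` W" by (simp add: kf)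
      qed
    qed
    moreover have "k ` W \<subseteq> V" using W kfW[of V] by blast
    ultimately have "k ` W = {0} \<or> k ` W = V" by (rule min)
    then show "W = {0} \<or> W = f ` V" using fkW[of W] lin_zero[OF lin] by auto
  qed
qed

lemma submodule_char_conj:
  assumes f: "f \<in> carrier Aut" and H: "\<forall>h\<in>H. lin h" and V: "invariant_subspace H V"
  shows "submodule_char (conj_subgroup Aut f H) (f ` V) = conj_char Aut f H (submodule_char H V)"
  unfolding submodule_char_def[of "conj_subgroup Aut f H"] conj_char_def
proof (rule restrict_ext)
  fix l assume "l \<in> conj_subgroup Aut f H"
  then obtain h where h: "h \<in> H" and l: "l = f \<circ> h \<circ> inv\<^bsub>Aut\<^esub> f" by (auto simp: conj_subgroup_def)
  have unconj: "inv\<^bsub>Aut\<^esub> f \<otimes>\<^bsub>Aut\<^esub> l \<otimes>\<^bsub>Aut\<^esub> f = h"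
    unfolding l by (simp add: fun_eq_iff inv_Aut[OF f])
  have lin: "lin f" and klin: "lin (inv\<^bsub>Aut\<^esub> f)" and hlin: "lin h"
    using Aut_memD(1)[OF f] Aut_memD(1)[OF inv_Aut(1)[OF f]] H h by auto
  have "trace_on (f ` V) l = trace_on V h"
  proof (rule trace_on_isomorphic[OF _ lin _ hlin])
    show "subspace V" "h ` V \<subseteq> V" using V h by (auto simp: invariant_subspace_def)
    show "inj_on f V" by (rule inj_on_inverseI) (rule inv_Aut(3)[OF f])
    show "lin l" unfolding l o_def by (rule lin_compose[OF lin_compose[OF lin hlin] klin])
    show "l (f v) = f (h v)" for v by (simp add: l inv_Aut(3)[OF f])
  qed
  then show "trace_on (f ` V) l = submodule_char H V (inv\<^bsub>Aut\<^esub> f \<otimes>\<^bsub>Aut\<^esub> l \<otimes>\<^bsub>Aut\<^esub> f)"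
    unfolding unconj using h by (simp add: submodule_char_def)
qed

text \<open>Extensionality is essential: \<open>conj_char\<close> sees only the values on \<open>H\<close>.\<close>

lemma conj_char_inject:
  assumes f: "f \<in> carrier Aut" and ext: "\<chi> \<in> extensional H" "\<psi> \<in> extensional H"
    and eq: "conj_char Aut f H \<chi> = conj_char Aut f H \<psi>"
  shows "\<chi> = \<psi>"
proof (rule extensionalityI[OF ext])
  fix h assume h: "h \<in> H"
  let ?l = "f \<circ> h \<circ> inv\<^bsub>Aut\<^esub> f"
  have l: "?l \<in> conj_subgroup Aut f H" using h by (auto simp: conj_subgroup_def)
  have unconj: "inv\<^bsub>Aut\<^esub> f \<otimes>\<^bsub>Aut\<^esub> ?l \<otimes>\<^bsub>Aut\<^esub> f = h"
    by (simp add: fun_eq_iff inv_Aut[OF f])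
  show "\<chi> h = \<psi> h"
    using fun_cong[OF eq, of ?l] l unconj by (simp add: conj_char_def)
qed

text \<open>The images of the summands under \<open>f\<close> decompose the algebra for the conjugate group, with conjugate
  characters, and by uniqueness they compute its isotypic components.\<close>

lemma conj_isotypic_decomposition:
  assumes f: "f \<in> carrier Aut" and H: "\<forall>h\<in>H. lin h"
    and V: "irreducible_decomposition H n V" and \<chi>: "\<chi> \<in> extensional H"
  shows "conj_isotypic H f \<chi> = f ` isotypic H \<chi>"
proof -
  let ?K = "conj_subgroup Aut f H"
  have lin: "lin f" by (rule Aut_memD(1)[OF f])
  have irr: "irreducible_submodule H (V i)" if "i < n" for i
    using V that by (simp add: irreducible_decomposition_def)
  have fV: "irreducible_decomposition ?K n (\<lambda>i. f ` V i)"
    using V direct_sum_decomposition_image[OF f, of "{..<n}" V] irreducible_submodule_conj[OF f]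
    by (simp add: irreducible_decomposition_def)
  have K: "\<forall>l\<in>?K. lin l"
  proof
    fix l assume "l \<in> ?K"
    then obtain h where h: "h \<in> H" and l: "l = f \<circ> h \<circ> inv\<^bsub>Aut\<^esub> f" by (auto simp: conj_subgroup_def)
    show "lin l" unfolding l o_def
      by (rule lin_compose[OF lin_compose[OF lin bspec[OF H h]] Aut_memD(1)[OF inv_Aut(1)[OF f]]])
  qed
  have "submodule_char ?K (f ` V i) = conj_char Aut f H \<chi> \<longleftrightarrow> submodule_char H (V i) = \<chi>" if "i < n" for i
    using submodule_char_conj[OF f H, of "V i"] irr[OF that] conj_char_inject[OF f _ \<chi>, of "submodule_char H (V i)"]
    by (auto simp: irreducible_submodule_def submodule_char_def)
  then have "{i. i < n \<and> submodule_char ?K (f ` V i) = conj_char Aut f H \<chi>} = {i. i < n \<and> submodule_char H (V i) = \<chi>}"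
    by blast
  then show ?thesis
    unfolding conj_isotypic_def isotypic_of_decomposition[OF K fV] isotypic_of_decomposition[OF H V]
    by (simp add: sum_space_image[OF lin])
qed

end

section \<open>Maschke's theorem\<close>

locale finite_automorphism_group = fd_algebra +
  fixes H :: "('a \<Rightarrow> 'a) set"
  assumes subgroup_H: "subgroup H Aut" and finite_H: "finite H"
begin

interpretation pair: vector_space_pair scale scale ..

abbreviation "GH \<equiv> Aut\<lparr>carrier := H\<rparr>"

lemma group_GH: "group GH"
  by (rule subgroup.subgroup_is_group[OF subgroup_H group_Aut])

lemma H_Aut: "h \<in> H \<Longrightarrow> h \<in> carrier Aut"
  using subgroup.subset[OF subgroup_H] by blast

lemma H_lin: "h \<in> H \<Longrightarrow> lin h"
  using Aut_memD(1)[OF H_Aut] .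

lemma H_comp: "h \<in> H \<Longrightarrow> k \<in> H \<Longrightarrow> h \<circ> k \<in> H"
  using subgroup.m_closed[OF subgroup_H] by simp

lemma H_inv: "h \<in> H \<Longrightarrow> inv\<^bsub>Aut\<^esub> h \<in> H"
  by (rule subgroup.m_inv_closed[OF subgroup_H])

lemma id_H: "id \<in> H"
  using subgroup.one_closed[OF subgroup_H] by simp

lemma inv_comp_H: "h \<in> H \<Longrightarrow> k \<in> H \<Longrightarrow> inv\<^bsub>Aut\<^esub> (h \<circ> k) = inv\<^bsub>Aut\<^esub> k \<circ> inv\<^bsub>Aut\<^esub> h"
  using group.inv_mult_group[OF group_Aut H_Aut H_Aut] by simp

lemma all_lin: "\<forall>h\<in>H. lin h"
  using H_lin by blast

text \<open>The average of \<open>h q h\<^sup>-\<^sup>1\<close> over \<open>H\<close>, where \<open>q\<close> is any linear projection onto \<open>W\<close>.\<close>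

lemma equivariant_projection:
  assumes W: "invariant_subspace H W"
  obtains p where "equivariant H p" "\<And>v. p v \<in> W" "\<And>w. w \<in> W \<Longrightarrow> p w = w"
proof -
  have Ws: "subspace W" and hW: "\<And>h w. h \<in> H \<Longrightarrow> w \<in> W \<Longrightarrow> h w \<in> W"
    using W by (auto simp: invariant_subspace_def)
  obtain q where q: "range q \<subseteq> W" "lin q" "\<And>w. w \<in> W \<Longrightarrow> q w = w"
    using pair.linear_exists_left_inverse_on[OF module_hom_ident Ws] by auto
  define c :: complex where "c = 1 / of_nat (card H)"
  \<comment> \<open>The group contains the identity, so its order can be divided by.\<close>
  have c: "c * of_nat (card H) = 1"
    using finite_H id_H by (auto simp: c_def)
  define p where "p v = c *s (\<Sum>h\<in>H. h (q ((inv\<^bsub>Aut\<^esub> h) v)))" for v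
  show thesis
  proof (rule that[of p])
    show "p v \<in> W" for v
      unfolding p_def using q(1) hW by (intro subspace_scale[OF Ws] subspace_sum[OF Ws]) blast
    show "p w = w" if "w \<in> W" for w
    proof -
      have "(\<Sum>h\<in>H. h (q ((inv\<^bsub>Aut\<^esub> h) w))) = (\<Sum>h\<in>H. w)"
        using that hW H_inv q(3) inv_Aut(2) H_Aut by (intro sum.cong) auto
      also have "\<dots> = of_nat (card H) *s w" by (simp add: sum_constant_scale)
      finally show ?thesis using c by (simp add: p_def)
    qed
    show "equivariant H p"
      unfolding equivariant_def
    proof (intro conjI ballI allI)
      have "lin (\<lambda>v. \<Sum>h\<in>H. h (q ((inv\<^bsub>Aut\<^esub> h) v)))"
        by (rule lin_sum_maps) (rule lin_compose[OF H_lin lin_compose[OF q(2) H_lin[OF H_inv]]])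
      from lin_compose[OF module_hom_scale_self this, of c]
      show "lin p" unfolding p_def[abs_def] .
    next
      fix k v assume k: "k \<in> H"
      have bij: "bij_betw (\<lambda>h. k \<circ> h) H H"
        by (rule bij_betw_byWitness[where f' = "\<lambda>h. inv\<^bsub>Aut\<^esub> k \<circ> h"])
           (use k H_comp H_inv inv_Aut(2,3)[OF H_Aut] in \<open>auto simp: fun_eq_iff\<close>)
      have "(\<Sum>h\<in>H. h (q ((inv\<^bsub>Aut\<^esub> h) (k v)))) = (\<Sum>h\<in>H. (k \<circ> h) (q ((inv\<^bsub>Aut\<^esub> (k \<circ> h)) (k v))))"
        by (rule sum.reindex_bij_betw[OF bij, symmetric])
      also have "\<dots> = (\<Sum>h\<in>H. k (h (q ((inv\<^bsub>Aut\<^esub> h) v))))"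
        using k by (intro sum.cong) (auto simp: inv_comp_H inv_Aut(3) H_Aut)
      also have "\<dots> = k (\<Sum>h\<in>H. h (q ((inv\<^bsub>Aut\<^esub> h) v)))"
        by (simp add: lin_sum[OF H_lin[OF k]])
      finally show "p (k v) = k (p v)" by (simp add: p_def lin_scale[OF H_lin[OF k]])
    qed
  qed
qed

text \<open>A nonzero invariant subspace of least dimension is irreducible.\<close>

lemma irreducible_submodule_exists:
  assumes U: "invariant_subspace H U" "U \<noteq> {0}"
  obtains W where "irreducible_submodule H W" "W \<subseteq> U"
proof -
  obtain C where C: "independent C" "span C = UNIV" "finite C"
    by (rule finite_basis)
  interpret fdv: finite_dimensional_vector_space scale C
    by unfold_locales (use C in auto)
  define Q where "Q = (\<lambda>W. invariant_subspace H W \<and> W \<noteq> {0} \<and> W \<subseteq> U)"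
  have "Q U" using U by (simp add: Q_def)
  then obtain W where W: "Q W" "\<And>W'. Q W' \<Longrightarrow> dim W \<le> dim W'"
    using ex_has_least_nat[of Q U dim] by blast
  have "W' = {0} \<or> W' = W" if W': "invariant_subspace H W'" "W' \<subseteq> W" for W'
  proof (cases "W' = {0}")
    case False
    then have "dim W \<le> dim W'" using W W' by (auto simp: Q_def)
    then show ?thesis
      using fdv.subspace_dim_equal[of W' W] W W' by (auto simp: Q_def invariant_subspace_def)
  qed simp
  then show thesis using W(1) by (intro that[of W]) (auto simp: Q_def irreducible_submodule_def)
qed

text \<open>Induction on the dimension: split off an irreducible submodule \<open>W\<close> of \<open>U\<close>; the kernel of an
  equivariant projection onto \<open>W\<close> is an invariant complement in \<open>U\<close>. Spanning and independence are
  stated separately since they pass through this step directly.\<close>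

lemma invariant_subspace_decomposes:
  assumes "invariant_subspace H U"
  shows "\<exists>n V. (\<forall>i<n::nat. irreducible_submodule H (V i) \<and> V i \<subseteq> U) \<and>
    (\<forall>u\<in>U. \<exists>f. (\<forall>i<n. f i \<in> V i) \<and> u = (\<Sum>i<n. f i)) \<and>
    (\<forall>f. (\<forall>i<n. f i \<in> V i) \<longrightarrow> (\<Sum>i<n. f i) = 0 \<longrightarrow> (\<forall>i<n. f i = 0))"
  using assms
proof (induction "dim U" arbitrary: U rule: less_induct)
  case less
  obtain C where C: "independent C" "span C = UNIV" "finite C"
    by (rule finite_basis)
  interpret fdv: finite_dimensional_vector_space scale C
    by unfold_locales (use C in auto)
  show ?case
  proof (cases "U = {0}")
    case True
    then show ?thesis by (intro exI[of _ 0]) auto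
  next
    case False
    obtain W where W: "irreducible_submodule H W" "W \<subseteq> U"
      using irreducible_submodule_exists[OF less.prems False] .
    have Wi: "invariant_subspace H W" and Wnz: "W \<noteq> {0}" and Ws: "subspace W"
      using W by (auto simp: irreducible_submodule_def invariant_subspace_def)
    obtain p where p: "equivariant H p" and pW: "\<And>v. p v \<in> W" and p_id: "\<And>w. w \<in> W \<Longrightarrow> p w = w"
      by (rule equivariant_projection[OF Wi]) blast
    have plin: "lin p" using p by (simp add: equivariant_def)
    have Us: "subspace U" using less.prems by (simp add: invariant_subspace_def)
    define U' where "U' = {u\<in>U. p u = 0}"
    have U'i: "invariant_subspace H U'"
      unfolding U'_def by (rule equivariant_kernel_invariant[OF all_lin p less.prems])
    have U's: "subspace U'" using U'i by (simp add: invariant_subspace_def)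
    obtain w where w: "w \<in> W" "w \<noteq> 0" using Wnz subspace_0[OF Ws] by blast
    then have "w \<in> U" "w \<notin> U'" using W(2) p_id[OF w(1)] by (auto simp: U'_def)
    then have "U' \<subset> U" by (auto simp: U'_def)
    then have "dim U' < dim U"
      using fdv.dim_psubset[of U' U] Us[folded span_eq_iff] U's[folded span_eq_iff] by simp
    from less.hyps[OF this U'i] obtain n V where
      V: "\<forall>i<n::nat. irreducible_submodule H (V i) \<and> V i \<subseteq> U'"
      and ex: "\<forall>u\<in>U'. \<exists>f. (\<forall>i<n. f i \<in> V i) \<and> u = (\<Sum>i<n. f i)"
      and ind: "\<forall>f. (\<forall>i<n. f i \<in> V i) \<longrightarrow> (\<Sum>i<n. f i) = 0 \<longrightarrow> (\<forall>i<n. f i = 0)"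
      by (elim exE conjE)
    show ?thesis
    proof (intro exI[of _ "Suc n"] exI[of _ "V(n := W)"] conjI allI impI ballI)
      fix i assume "i < Suc n"
      then show "irreducible_submodule H ((V(n := W)) i)" "(V(n := W)) i \<subseteq> U"
        using V W \<open>U' \<subset> U\<close> by (auto simp: less_Suc_eq)
    next
      fix u assume u: "u \<in> U"
      then have "u - p u \<in> U'"
        using pW[of u] W(2) Us by (auto simp: U'_def lin_diff[OF plin] p_id intro: subspace_diff)
      from bspec[OF ex this] obtain f where f: "\<forall>i<n. f i \<in> V i" "u - p u = (\<Sum>i<n. f i)" by blast
      have "u = (\<Sum>i<n. f i) + p u" by (simp add: f(2)[symmetric])
      then show "\<exists>f. (\<forall>i<Suc n. f i \<in> (V(n := W)) i) \<and> u = (\<Sum>i<Suc n. f i)"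
        using f(1) pW by (intro exI[of _ "f(n := p u)"]) (auto simp: less_Suc_eq)
    next
      fix f i assume f: "\<forall>i<Suc n. f i \<in> (V(n := W)) i" "(\<Sum>i<Suc n. f i) = 0" and i: "i < Suc n"
      have fn: "f n \<in> W" and fV: "\<forall>i<n. f i \<in> V i" using f(1) by (auto simp: less_Suc_eq)
      have "p (\<Sum>i<n. f i) = 0"
        using fV V by (auto simp: lin_sum[OF plin] U'_def intro!: sum.neutral)
      then have "f n = p (\<Sum>i<Suc n. f i)" by (simp add: lin_add[OF plin] p_id[OF fn])
      then have "f n = 0" using f(2) by (simp add: lin_zero[OF plin])
      moreover then have "\<forall>i<n. f i = 0" using ind fV f(2) by simp
      ultimately show "f i = 0" using i by (auto simp: less_Suc_eq)
    qed
  qed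
qed

lemma maschke:
  obtains n V where "irreducible_decomposition H n V"
proof -
  have "invariant_subspace H UNIV" by (simp add: invariant_subspace_def)
  from invariant_subspace_decomposes[OF this] obtain n V where
    irr: "\<forall>i<n::nat. irreducible_submodule H (V i) \<and> V i \<subseteq> UNIV"
    and ex: "\<forall>u\<in>UNIV. \<exists>f. (\<forall>i<n. f i \<in> V i) \<and> u = (\<Sum>i<n. f i)"
    and ind: "\<forall>f. (\<forall>i<n. f i \<in> V i) \<longrightarrow> (\<Sum>i<n. f i) = 0 \<longrightarrow> (\<forall>i<n. f i = 0)"
    by (elim exE conjE)
  have "direct_sum_decomposition {..<n} V"
  proof (rule direct_sum_decomposition_lessThanI)
    show "subspace (V i)" if "i < n" for i
      using irr that by (simp add: irreducible_submodule_def invariant_subspace_def)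
  qed (use ex ind in simp_all)
  then show thesis using irr by (intro that[of n V]) (simp add: irreducible_decomposition_def)
qed

section \<open>Submodules as matrix representations\<close>

lemma submodule_rep:
  assumes b: "ordered_basis n b V" and V: "invariant_subspace H V"
  shows "matrix_rep GH n (rep_mat n b)" "rep_char GH n (rep_mat n b) = submodule_char H V"
proof -
  have hV: "h ` V \<subseteq> V" if "h \<in> H" for h using V that by (simp add: invariant_subspace_def)
  have "rep_mat n b (h \<circ> k) = rep_mat n b h * rep_mat n b k" if h: "h \<in> H" and k: "k \<in> H" for h k
  proof (rule eq_matI)
    fix i j assume "i < dim_row (rep_mat n b h * rep_mat n b k)" "j < dim_col (rep_mat n b h * rep_mat n b k)"
    then have ij: "i < n" "j < n" by (auto simp: rep_mat_def)
    have "k (b j) \<in> V" using hV[OF k] ordered_basis_mem[OF b ij(2)] by auto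
    from coord_lin[OF b b H_lin[OF h] hV[OF h] this]
    show "rep_mat n b (h \<circ> k) $$ (i, j) = (rep_mat n b h * rep_mat n b k) $$ (i, j)"
      using ij by (simp add: mult_index[of _ n n _ n] rep_mat_def del: index_mult_mat)
  qed (auto simp: rep_mat_def)
  moreover have "rep_mat n b id = 1\<^sub>m n"
    by (rule eq_matI) (auto simp: rep_mat_def coord_basis[OF b])
  ultimately show "matrix_rep GH n (rep_mat n b)" by (simp add: matrix_rep_def)
  show "rep_char GH n (rep_mat n b) = submodule_char H V"
    unfolding rep_char_def submodule_char_def
    by (auto intro!: restrict_ext simp: rep_mat_def trace_on_ordered_basis[OF b H_lin hV])
qed

text \<open>Taking linear combinations of the basis \<open>b\<close> turns invariant subspaces of coordinate vectors into
  invariant subspaces of \<open>V\<close>.\<close>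

lemma irreducible_submodule_rep:
  assumes b: "ordered_basis n b V" and V: "irreducible_submodule H V"
  shows "irreducible_rep GH n (rep_mat n b)"
proof -
  have Vi: "invariant_subspace H V" and nz: "V \<noteq> {0}"
    using V by (auto simp: irreducible_submodule_def)
  have hV: "h ` V \<subseteq> V" if "h \<in> H" for h using Vi that by (simp add: invariant_subspace_def)
  have "U = {0\<^sub>v n} \<or> U = carrier_vec n"
    if U: "vec_subspace n U" and inv: "\<forall>h\<in>H. \<forall>u\<in>U. rep_mat n b h *\<^sub>v u \<in> U" for U
  proof -
    have Uc: "U \<subseteq> carrier_vec n" and U0: "0\<^sub>v n \<in> U"
      and Uadd: "\<And>u v. u \<in> U \<Longrightarrow> v \<in> U \<Longrightarrow> u + v \<in> U" and Uscale: "\<And>c u. u \<in> U \<Longrightarrow> c \<cdot>\<^sub>v u \<in> U"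
      using U by (auto simp: vec_subspace_def)
    define W where "W = lincomb n b ` U"
    have "subspace W"
      unfolding subspace_def
    proof (intro conjI ballI allI)
      show "0 \<in> W" using U0 lincomb_zero[of n b] by (force simp: W_def)
    next
      fix x y assume "x \<in> W" "y \<in> W"
      then obtain u v where "u \<in> U" "v \<in> U" "x = lincomb n b u" "y = lincomb n b v" by (auto simp: W_def)
      then have "x + y = lincomb n b (u + v)" "u + v \<in> U" using lincomb_add[OF subsetD[OF Uc] subsetD[OF Uc]] Uadd by simp_all
      then show "x + y \<in> W" by (simp add: W_def)
    next
      fix c x assume "x \<in> W"
      then obtain u where "u \<in> U" "x = lincomb n b u" by (auto simp: W_def)
      then have "c *s x = lincomb n b (c \<cdot>\<^sub>v u)" "c \<cdot>\<^sub>v u \<in> U" using lincomb_scale[OF subsetD[OF Uc]] Uscale by simp_all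
      then show "c *s x \<in> W" by (simp add: W_def)
    qed
    moreover have "h (lincomb n b u) \<in> W" if "h \<in> H" "u \<in> U" for h u
      unfolding W_def lin_lincomb[OF b H_lin[OF that(1)] hV[OF that(1)] subsetD[OF Uc that(2)]]
      using that inv by blast
    ultimately have "invariant_subspace H W" by (auto simp: invariant_subspace_def W_def)
    moreover have "W \<subseteq> V" using lincomb_in[OF b] by (auto simp: W_def)
    ultimately consider "W = {0}" | "W = V" using V by (auto simp: irreducible_submodule_def)
    then show ?thesis
    proof cases
      case 1
      have "u = 0\<^sub>v n" if u: "u \<in> U" for u
      proof -
        have "lincomb n b u \<in> W" unfolding W_def using u by (rule imageI)
        then have "lincomb n b u = lincomb n b (0\<^sub>v n)" using 1 by (simp add: lincomb_zero)
        then show ?thesis by (rule lincomb_inject[OF b subsetD[OF Uc u] zero_carrier_vec])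
      qed
      then show ?thesis using U0 by blast
    next
      case 2
      have "u \<in> U" if u: "u \<in> carrier_vec n" for u
      proof -
        have "lincomb n b u \<in> W" using 2 lincomb_in[OF b] by simp
        then obtain u' where u': "u' \<in> U" "lincomb n b u = lincomb n b u'" unfolding W_def by blast
        then have "u = u'" by (intro lincomb_inject[OF b u] subsetD[OF Uc])
        then show ?thesis using u' by simp
      qed
      then show ?thesis using Uc by blast
    qed
  qed
  moreover have "n \<noteq> 0" using b nz by (auto simp: ordered_basis_def)
  ultimately show ?thesis
    using submodule_rep(1)[OF b Vi] by (simp add: irreducible_rep_def)
qed

lemma submodule_char_in_Irr:
  assumes "irreducible_submodule H V"
  shows "submodule_char H V \<in> Irr GH"
proof -
  have V: "invariant_subspace H V" "subspace V"
    using assms by (auto simp: irreducible_submodule_def invariant_subspace_def)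
  obtain n b where b: "ordered_basis n b V" using ordered_basis_exists[OF V(2)] .
  then show ?thesis
    unfolding Irr_def using submodule_rep(2)[OF b V(1), symmetric] irreducible_submodule_rep[OF b assms]
    by (intro CollectI exI conjI)
qed

text \<open>By the character value at the identity, \<open>V\<close> is a line on which \<open>H\<close> acts by one-by-one identity
  matrices.\<close>

lemma trivial_submodule:
  assumes V: "irreducible_submodule H V" and triv: "submodule_char H V = trivial_char GH"
  shows "h \<in> H \<Longrightarrow> v \<in> V \<Longrightarrow> h v = v" "\<exists>b. V = span {b}"
proof -
  have Vi: "invariant_subspace H V" "subspace V"
    using V by (auto simp: irreducible_submodule_def invariant_subspace_def)
  obtain n b where b: "ordered_basis n b V" using ordered_basis_exists[OF Vi(2)] .
  note rep = submodule_rep[OF b Vi(1)]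
  have n: "n = 1" and one: "\<And>h. h \<in> H \<Longrightarrow> rep_mat n b h = 1\<^sub>m 1"
    using rep_of_trivial_char[OF group_GH rep(1)] rep(2) triv by auto
  show "\<exists>b. V = span {b}" using b n by (auto simp: ordered_basis_def lessThan_Suc)
  assume h: "h \<in> H" and v: "v \<in> V"
  have hV: "h ` V \<subseteq> V" using Vi h by (simp add: invariant_subspace_def)
  have "h v = lincomb n b (rep_mat n b h *\<^sub>v vec n (coord n b v))"
    using lin_lincomb[OF b H_lin[OF h] hV, of "vec n (coord n b v)"] by (simp add: lincomb_coord[OF b v])
  also have "rep_mat n b h *\<^sub>v vec n (coord n b v) = vec n (coord n b v)"
    unfolding one[OF h] using n by (intro one_mult_mat_vec) simp
  finally show "h v = v" by (simp add: lincomb_coord[OF b v])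
qed

section \<open>The fusion rule for isotypic components\<close>

text \<open>The matrix \<open>Q\<close> of the linear map \<open>a \<otimes> b \<mapsto> P (a b)\<close> from \<open>U \<otimes> V\<close> to \<open>W\<close> intertwines the Kronecker
  product of the representations on \<open>U\<close> and \<open>V\<close> with that on \<open>W\<close>, since \<open>h (a b) = h a h b\<close> and \<open>P\<close>
  commutes with \<open>h\<close>. It is not zero because \<open>P (x y)\<close> is not.\<close>

lemma constituent_of_product:
  assumes U: "irreducible_submodule H U" and V: "irreducible_submodule H V" and W: "irreducible_submodule H W"
    and P: "equivariant H P" "\<And>v. P v \<in> W" and nz: "x \<in> U" "y \<in> V" "P (x \<cdot> y) \<noteq> 0"
  shows "submodule_char H W \<in> snd (rep_fusion_law GH) (submodule_char H U) (submodule_char H V)"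
proof -
  have inv: "invariant_subspace H U" "invariant_subspace H V" "invariant_subspace H W"
    and sub: "subspace U" "subspace V" "subspace W"
    using U V W by (auto simp: irreducible_submodule_def invariant_subspace_def)
  obtain l a where a: "ordered_basis l a U" using ordered_basis_exists[OF sub(1)] .
  obtain m b where b: "ordered_basis m b V" using ordered_basis_exists[OF sub(2)] .
  obtain n c where c: "ordered_basis n c W" using ordered_basis_exists[OF sub(3)] .
  have Plin: "lin P" and Ph: "\<And>h v. h \<in> H \<Longrightarrow> P (h v) = h (P v)"
    using P(1) by (auto simp: equivariant_def)
  have expand: "coord n c (P (u \<cdot> v)) k
      = (\<Sum>s<l. \<Sum>t<m. coord n c (P (a s \<cdot> b t)) k * (coord l a u s * coord m b v t))"
    if u: "u \<in> U" and v: "v \<in> V" for u v k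
  proof -
    have "coord n c (P (u \<cdot> v)) k = (\<Sum>s<l. coord n c (P (a s \<cdot> v)) k * coord l a u s)"
      by (rule coord_lin[OF a c lin_compose[OF Plin linear_left] _ u]) (use P(2) in auto)
    also have "\<dots> = (\<Sum>s<l. (\<Sum>t<m. coord n c (P (a s \<cdot> b t)) k * coord m b v t) * coord l a u s)"
      by (intro sum.cong refl arg_cong2[where f = "(*)"]
          coord_lin[OF b c lin_compose[OF Plin linear_right] _ v]) (use P(2) in auto)
    also have "\<dots> = (\<Sum>s<l. \<Sum>t<m. coord n c (P (a s \<cdot> b t)) k * (coord l a u s * coord m b v t))"
      unfolding sum_distrib_right by (intro sum.cong refl) (simp add: mult_ac)
    finally show ?thesis .
  qed
  \<comment> \<open>The column with index \<open>s * m + t\<close> holds the coordinates of \<open>P (a s \<cdot> b t)\<close>.\<close>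
  define Q where "Q = mat n (l * m) (\<lambda>(k, r). coord n c (P (a (r div m) \<cdot> b (r mod m))) k)"
  have Q: "Q \<in> carrier_mat n (l * m)" by (simp add: Q_def)
  have "Q \<noteq> 0\<^sub>m n (l * m)"
  proof
    assume Q0: "Q = 0\<^sub>m n (l * m)"
    have zero: "coord n c (P (a s \<cdot> b t)) k = 0" if "s < l" "t < m" "k < n" for s t k
    proof -
      have "s * m + t < l * m"
        using that by (metis div_less_iff_less_mult div_mult_self3 add.commute div_less add_0 gr_implies_not0 not_gr0)
      then have "Q $$ (k, s * m + t) = coord n c (P (a s \<cdot> b t)) k" using that by (simp add: Q_def)
      then show ?thesis using Q0 \<open>s * m + t < l * m\<close> that by simp
    qed
    have "coord n c (P (x \<cdot> y)) k = 0" if "k < n" for k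
      unfolding expand[OF nz(1,2)] using zero that by (simp add: sum.neutral)
    then have "P (x \<cdot> y) = 0"
      using sum_coord[OF c P(2), of "x \<cdot> y"] by simp
    with nz show False by simp
  qed
  moreover have "Q * kronecker (rep_mat l a h) (rep_mat m b h) = rep_mat n c h * Q" if h: "h \<in> H" for h
  proof (rule eq_matI)
    have K: "kronecker (rep_mat l a h) (rep_mat m b h) \<in> carrier_mat (l * m) (l * m)"
      by (rule kronecker_carrier) simp_all
    show "dim_row (Q * kronecker (rep_mat l a h) (rep_mat m b h)) = dim_row (rep_mat n c h * Q)"
      "dim_col (Q * kronecker (rep_mat l a h) (rep_mat m b h)) = dim_col (rep_mat n c h * Q)"
      using K by (auto simp: Q_def rep_mat_def)
    fix k r assume "k < dim_row (rep_mat n c h * Q)" "r < dim_col (rep_mat n c h * Q)"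
    then have kr: "k < n" "r < l * m" by (auto simp: Q_def rep_mat_def)
    let ?i = "r div m" and ?j = "r mod m"
    have ij: "?i < l" "?j < m" using kr by (auto intro: div_less_of_less_mult mod_less_of_less_mult)
    have aU: "a ?i \<in> U" and bV: "b ?j \<in> V"
      using ordered_basis_mem[OF a ij(1)] ordered_basis_mem[OF b ij(2)] .
    have haU: "h (a ?i) \<in> U" and hbV: "h (b ?j) \<in> V" and hW: "h ` W \<subseteq> W"
      using inv h aU bV by (simp_all add: invariant_subspace_def image_subset_iff)
    have "(Q * kronecker (rep_mat l a h) (rep_mat m b h)) $$ (k, r)
        = (\<Sum>q<l * m. coord n c (P (a (q div m) \<cdot> b (q mod m))) k *
            (coord l a (h (a ?i)) (q div m) * coord m b (h (b ?j)) (q mod m)))"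
      unfolding mult_index[OF Q K kr] using kr ij
      by (intro sum.cong refl) (auto simp: kronecker_index[of _ l l _ m m] Q_def rep_mat_def
          div_less_of_less_mult mod_less_of_less_mult)
    also have "\<dots> = (\<Sum>s<l. \<Sum>t<m. coord n c (P (a s \<cdot> b t)) k *
            (coord l a (h (a ?i)) s * coord m b (h (b ?j)) t))"
      by (rule sum_lessThan_mult_nat)
    also have "\<dots> = coord n c (P (h (a ?i) \<cdot> h (b ?j))) k" by (rule expand[OF haU hbV, symmetric])
    also have "P (h (a ?i) \<cdot> h (b ?j)) = h (P (a ?i \<cdot> b ?j))"
      using Ph[OF h] Aut_memD(3)[OF H_Aut[OF h]] by metis
    also have "coord n c (h (P (a ?i \<cdot> b ?j))) k
        = (\<Sum>q<n. coord n c (h (c q)) k * coord n c (P (a ?i \<cdot> b ?j)) q)"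
      by (rule coord_lin[OF c c H_lin[OF h] hW P(2)])
    also have "\<dots> = (rep_mat n c h * Q) $$ (k, r)"
      using kr by (simp add: mult_index[of _ n n _ "l * m"] Q_def rep_mat_def del: index_mult_mat)
    finally show "(Q * kronecker (rep_mat l a h) (rep_mat m b h)) $$ (k, r) = (rep_mat n c h * Q) $$ (k, r)" .
  qed
  moreover note irrU = irreducible_submodule_rep[OF a U] and irrV = irreducible_submodule_rep[OF b V]
    and irrW = irreducible_submodule_rep[OF c W]
  moreover have "matrix_rep GH (l * m) (\<lambda>h. kronecker (rep_mat l a h) (rep_mat m b h))"
    by (intro matrix_rep_kronecker submodule_rep(1)[OF a inv(1)] submodule_rep(1)[OF b inv(2)])
  ultimately have "constituent GH (l * m) (\<lambda>h. kronecker (rep_mat l a h) (rep_mat m b h)) (rep_char GH n (rep_mat n c))"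
    using finite_H by (intro constituent_if_intertwiner_onto[OF group_GH _ _ _ Q]) auto
  then have con: "constituent GH (l * m) (\<lambda>h. kronecker (rep_mat l a h) (rep_mat m b h)) (submodule_char H W)"
    unfolding submodule_rep(2)[OF c inv(3)] .
  show ?thesis
    unfolding rep_fusion_law_def snd_conv
    by (intro CollectI exI conjI, rule irrU, rule submodule_rep(2)[OF a inv(1), symmetric],
        rule irrV, rule submodule_rep(2)[OF b inv(2), symmetric], rule con)
qed

abbreviation "\<Phi> \<equiv> rep_fusion_law GH"

lemma fst_\<Phi>: "fst \<Phi> = Irr GH"
  by (simp add: rep_fusion_law_def)

text \<open>Expand both factors and the product into irreducible components. A nonzero component of the product
  in \<open>V k\<close> comes from some components of the factors in \<open>V i\<close> and \<open>V j\<close>, and \<open>constituent_of_product\<close>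
  puts the character of \<open>V k\<close> into the product of the characters of \<open>V i\<close> and \<open>V j\<close>.\<close>

lemma fusion_decomposition_isotypic: "fusion_decomposition \<Phi> (isotypic H)"
proof -
  obtain n V where V: "irreducible_decomposition H n V" by (rule maschke)
  have ds: "direct_sum_decomposition {..<n} V" and irr: "\<And>i. i < n \<Longrightarrow> irreducible_submodule H (V i)"
    using V by (auto simp: irreducible_decomposition_def)
  obtain P where P: "projections {..<n} V P" by (rule direct_sum_decompositionE[OF ds])
  have Plin: "lin (P i)" and PV: "P i v \<in> V i" if "i < n" for i v
    using projectionsD[OF P] that by simp_all
  note iso = isotypic_of_decomposition[OF all_lin V]
  have comp: "submodule_char H (V i) = \<chi>" if "v \<in> isotypic H \<chi>" "i < n" "P i v \<noteq> 0" for i v \<chi>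
    using that(1) unfolding iso by (subst (asm) sum_space_iff[OF ds P]) (use that in auto)
  have "direct_sum_decomposition (Irr GH) (isotypic H)"
    using direct_sum_decomposition_group[OF ds, of "\<lambda>i. submodule_char H (V i)" "Irr GH"]
      submodule_char_in_Irr[OF irr] by (simp add: iso[abs_def])
  moreover have "a \<cdot> b \<in> sum_space (snd \<Phi> \<chi> \<psi>) (isotypic H)"
    if a: "a \<in> isotypic H \<chi>" and b: "b \<in> isotypic H \<psi>" for a b \<chi> \<psi>
  proof -
    let ?S = "sum_space (snd \<Phi> \<chi> \<psi>) (isotypic H)"
    have "P k (a \<cdot> b) \<in> ?S" if k: "k < n" for k
    proof (cases "P k (a \<cdot> b) = 0")
      case True
      then show ?thesis using subspace_0[OF subspace_sum_space] by simp
    next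
      case False
      have "a \<cdot> b = (\<Sum>i<n. P i a) \<cdot> (\<Sum>j<n. P j b)" by (simp add: projections_lessThan_sum[OF P])
      also have "\<dots> = (\<Sum>i<n. \<Sum>j<n. P i a \<cdot> P j b)" by (simp only: mul_sum_left) (simp only: mul_sum_right)
      finally have "P k (a \<cdot> b) = (\<Sum>i<n. \<Sum>j<n. P k (P i a \<cdot> P j b))"
        by (simp add: lin_sum[OF Plin[OF k]])
      then obtain i where i: "i < n" "(\<Sum>j<n. P k (P i a \<cdot> P j b)) \<noteq> 0"
        using False by (metis (mono_tags, lifting) lessThan_iff sum.neutral)
      then obtain j where j: "j < n" "P k (P i a \<cdot> P j b) \<noteq> 0"
        by (metis (mono_tags, lifting) lessThan_iff sum.neutral)
      have "P i a \<noteq> 0" "P j b \<noteq> 0"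
        using j(2) lin_zero[OF Plin[OF k]] lin_zero[OF linear_left] lin_zero[OF linear_right] by auto
      then have \<chi>: "submodule_char H (V i) = \<chi>" and \<psi>: "submodule_char H (V j) = \<psi>"
        using comp[OF a i(1)] comp[OF b j(1)] by auto
      have "submodule_char H (V k) \<in> snd \<Phi> \<chi> \<psi>"
        using constituent_of_product[OF irr[OF i(1)] irr[OF j(1)] irr[OF k]
            projection_equivariant[OF all_lin V P k] PV[OF k] PV[OF i(1)] PV[OF j(1)] j(2)]
        by (simp only: \<chi> \<psi>)
      moreover have "P k (a \<cdot> b) \<in> isotypic H (submodule_char H (V k))"
        unfolding iso by (rule sum_space_memI[of k]) (simp_all add: k PV)
      ultimately show ?thesis by (rule sum_space_memI[where D = "isotypic H"])
    qed
    then have "(\<Sum>k<n. P k (a \<cdot> b)) \<in> ?S" by (intro subspace_sum[OF subspace_sum_space]) auto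
    then show ?thesis by (simp add: projections_lessThan_sum[OF P])
  qed
  ultimately show ?thesis by (simp add: fusion_decomposition_def fst_\<Phi>)
qed

section \<open>Axes\<close>

lemma isotypic_subspace: "subspace (isotypic H \<chi>)"
proof -
  obtain n V where V: "irreducible_decomposition H n V" by (rule maschke)
  show ?thesis unfolding isotypic_of_decomposition[OF all_lin V] by (rule subspace_sum_space)
qed

lemma isotypic_trivial_fixed:
  assumes a: "a \<in> isotypic H (trivial_char GH)" and h: "h \<in> H"
  shows "h a = a"
proof -
  obtain n V where V: "irreducible_decomposition H n V" by (rule maschke)
  have "subspace {v. h v = v}"
    by (auto simp: subspace_def lin_add[OF H_lin[OF h]] lin_scale[OF H_lin[OF h]] lin_zero[OF H_lin[OF h]])
  moreover have "V i \<subseteq> {v. h v = v}" if "i < n" "submodule_char H (V i) = trivial_char GH" for i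
    using trivial_submodule(1)[OF _ that(2) h] V that(1) by (auto simp: irreducible_decomposition_def)
  ultimately have "isotypic H (trivial_char GH) \<subseteq> {v. h v = v}"
    unfolding isotypic_of_decomposition[OF all_lin V] sum_space_def by (intro span_minimal) auto
  then show ?thesis using a by blast
qed

lemma isotypic_multiplicity_free:
  assumes mf: "multiplicity_free H" and nz: "isotypic H \<chi> \<noteq> {0}"
  shows "irreducible_submodule H (isotypic H \<chi>)" "submodule_char H (isotypic H \<chi>) = \<chi>"
proof -
  obtain n V where V: "irreducible_decomposition H n V"
    and inj: "\<And>i j. i < n \<Longrightarrow> j < n \<Longrightarrow> submodule_char H (V i) = submodule_char H (V j) \<Longrightarrow> i = j"
    using mf unfolding multiplicity_free_def by blast
  note iso = isotypic_of_decomposition[OF all_lin V]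
  have "{i. i < n \<and> submodule_char H (V i) = \<chi>} \<noteq> {}"
  proof
    assume "{i. i < n \<and> submodule_char H (V i) = \<chi>} = {}"
    then have "isotypic H \<chi> = span {}" unfolding iso by (simp only: sum_space_def) simp
    then show False using nz by simp
  qed
  then obtain i where i: "i < n" "submodule_char H (V i) = \<chi>" by blast
  then have "{j. j < n \<and> submodule_char H (V j) = \<chi>} = {i}" using inj by auto
  moreover have irr: "irreducible_submodule H (V i)" using V i by (simp add: irreducible_decomposition_def)
  moreover then have "span (V i) = V i" by (simp add: irreducible_submodule_def invariant_subspace_def span_eq_iff)
  ultimately have "isotypic H \<chi> = V i" by (simp add: iso sum_space_def)
  with irr i show "irreducible_submodule H (isotypic H \<chi>)" "submodule_char H (isotypic H \<chi>) = \<chi>" by auto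
qed

text \<open>Left multiplication by \<open>a\<close> commutes with \<open>H\<close> because \<open>H\<close> fixes \<open>a\<close>, and it maps each component
  into itself because the trivial character is a unit, so Schur's lemma applies.\<close>

lemma axis_isotypic:
  assumes mf: "multiplicity_free H" and a: "a \<in> isotypic H (trivial_char GH)" "a \<noteq> 0"
  shows "axis \<Phi> (trivial_char GH) (isotypic H) a"
proof -
  let ?e = "trivial_char GH"
  note unit = fusion_unit_trivial_char[OF group_GH]
  have "\<exists>c. \<forall>b\<in>isotypic H \<chi>. a \<cdot> b = c *s b" if \<chi>: "\<chi> \<in> Irr GH" for \<chi>
  proof (cases "isotypic H \<chi> = {0}")
    case True
    then show ?thesis using lin_zero[OF linear_right] by auto
  next
    case False
    have "equivariant H (\<lambda>b. a \<cdot> b)"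
      unfolding equivariant_def
    proof (intro conjI ballI allI)
      fix h v assume h: "h \<in> H"
      show "a \<cdot> h v = h (a \<cdot> v)"
        using Aut_memD(3)[OF H_Aut[OF h], of a v] isotypic_trivial_fixed[OF a(1) h] by simp
    qed (rule linear_right)
    moreover have "a \<cdot> b \<in> isotypic H \<chi>" if b: "b \<in> isotypic H \<chi>" for b
    proof -
      have e: "?e \<in> Irr GH" and sub: "snd \<Phi> ?e \<chi> \<subseteq> {\<chi>}"
        using unit \<chi> by (auto simp: fusion_unit_def fst_\<Phi>)
      have "a \<cdot> b \<in> sum_space (snd \<Phi> ?e \<chi>) (isotypic H)"
        using fusion_decomposition_isotypic e \<chi> a b by (simp add: fusion_decomposition_def fst_\<Phi>)
      also have "\<dots> \<subseteq> isotypic H \<chi>"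
        unfolding sum_space_def using sub by (intro span_minimal isotypic_subspace) auto
      finally show ?thesis .
    qed
    ultimately show ?thesis
      using isotypic_multiplicity_free(1)[OF mf False] by (intro schur_scalar[OF all_lin]) auto
  qed
  then show ?thesis using unit a by (simp add: axis_def fst_\<Phi>)
qed

lemma isotypic_trivial_proportional:
  assumes mf: "multiplicity_free H" and a: "a \<in> isotypic H (trivial_char GH)" "a \<noteq> 0"
    and b: "b \<in> isotypic H (trivial_char GH)"
  obtains c where "b = c *s a"
proof -
  have "isotypic H (trivial_char GH) \<noteq> {0}" using a by auto
  from trivial_submodule(2)[OF isotypic_multiplicity_free[OF mf this]]
  obtain v where "isotypic H (trivial_char GH) = span {v}" by blast
  then obtain r s where r: "a = r *s v" and s: "b = s *s v" using a b by (auto simp: span_singleton)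
  have "r \<noteq> 0" using r a by auto
  then have "b = (s / r) *s a" by (simp add: r s)
  then show thesis by (rule that)
qed

lemma conj_isotypic_eq:
  assumes f: "f \<in> carrier Aut" and \<chi>: "\<chi> \<in> Irr GH"
  shows "conj_isotypic H f \<chi> = f ` isotypic H \<chi>"
proof -
  obtain n V where "irreducible_decomposition H n V" by (rule maschke)
  moreover have "\<chi> \<in> extensional H" using \<chi> by (auto simp: Irr_def rep_char_def)
  ultimately show ?thesis by (intro conj_isotypic_decomposition[OF f all_lin])
qed

lemma decomposition_algebra_conj_isotypic:
  assumes "\<forall>i\<in>I. g i \<in> carrier Aut"
  shows "decomposition_algebra \<Phi> I (\<lambda>i. conj_isotypic H (g i))"
  unfolding decomposition_algebra_def
proof (intro conjI ballI is_fusion_law_rep)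
  fix i assume "i \<in> I"
  then have gi: "g i \<in> carrier Aut" using assms by blast
  show "fusion_decomposition \<Phi> (conj_isotypic H (g i))"
    by (rule fusion_decomposition_cong[OF is_fusion_law_rep _
          fusion_decomposition_image[OF gi fusion_decomposition_isotypic]])
       (simp add: conj_isotypic_eq[OF gi] fst_\<Phi>)
qed

lemma trivial_char_Irr: "trivial_char GH \<in> Irr GH"
  by (rule trivial_char_in_Irr[OF group_GH])

lemma axis_conj_isotypic:
  assumes mf: "multiplicity_free H" and f: "f \<in> carrier Aut"
    and a: "a \<in> isotypic H (trivial_char GH)" "a \<noteq> 0"
  shows "axis \<Phi> (trivial_char GH) (conj_isotypic H f) (f a)"
  using axis_image[OF f axis_isotypic[OF mf a]] trivial_char_Irr
  by (simp add: axis_def fst_\<Phi> conj_isotypic_eq[OF f])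

text \<open>The automorphism \<open>g i\<close> transports \<open>a b = c b\<close> to the conjugate decomposition with the same
  scalar \<open>c\<close>, so the scalars depend only on \<open>a\<close>. For an empty index set there may be no such \<open>a\<close>,
  and any scalars will do.\<close>

lemma axial_decomposition_algebra_orbit:
  assumes mf: "multiplicity_free H" and g: "\<forall>i\<in>I. g i \<in> carrier Aut"
    and a: "I \<noteq> {} \<Longrightarrow> a \<in> isotypic H (trivial_char GH) \<and> a \<noteq> 0" and \<alpha>: "\<forall>i\<in>I. \<alpha> i = g i a"
  shows "axial_decomposition_algebra \<Phi> (trivial_char GH) I (\<lambda>i. conj_isotypic H (g i)) \<alpha>"
proof -
  have "\<exists>c. \<forall>i\<in>I. \<alpha> i \<in> conj_isotypic H (g i) (trivial_char GH) \<and> \<alpha> i \<noteq> 0 \<and>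
      (\<forall>\<chi>\<in>Irr GH. \<forall>b\<in>conj_isotypic H (g i) \<chi>. \<alpha> i \<cdot> b = c \<chi> *s b)"
  proof (cases "I = {}")
    case False
    then have a: "a \<in> isotypic H (trivial_char GH)" "a \<noteq> 0" using a by auto
    have "\<forall>\<chi>\<in>Irr GH. \<exists>c. \<forall>b\<in>isotypic H \<chi>. a \<cdot> b = c *s b"
      using axis_isotypic[OF mf a] by (simp add: axis_def fst_\<Phi>)
    then obtain c where c: "\<And>\<chi> b. \<chi> \<in> Irr GH \<Longrightarrow> b \<in> isotypic H \<chi> \<Longrightarrow> a \<cdot> b = c \<chi> *s b" by metis
    show ?thesis
    proof (intro exI[of _ c] ballI conjI)
      fix i assume i: "i \<in> I"
      have gi: "g i \<in> carrier Aut" and \<alpha>i: "\<alpha> i = g i a" using g \<alpha> i by auto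
      show "\<alpha> i \<in> conj_isotypic H (g i) (trivial_char GH)" "\<alpha> i \<noteq> 0"
        using axis_conj_isotypic[OF mf gi a] by (simp_all add: axis_def \<alpha>i)
      fix \<chi> b assume \<chi>: "\<chi> \<in> Irr GH" "b \<in> conj_isotypic H (g i) \<chi>"
      then obtain v where v: "v \<in> isotypic H \<chi>" "b = g i v" by (auto simp: conj_isotypic_eq[OF gi])
      have "\<alpha> i \<cdot> b = g i (a \<cdot> v)" by (simp add: \<alpha>i v Aut_memD(3)[OF gi])
      also have "\<dots> = c \<chi> *s b" by (simp add: c[OF \<chi>(1) v(1)] v(2) lin_scale[OF Aut_memD(1)[OF gi]])
      finally show "\<alpha> i \<cdot> b = c \<chi> *s b" .
    qed
  qed simp
  then show ?thesis
    using decomposition_algebra_conj_isotypic[OF g] fusion_unit_trivial_char[OF group_GH]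
    by (simp add: axial_decomposition_algebra_def fst_\<Phi>)
qed

text \<open>Write \<open>\<alpha> i = g i (b i)\<close>. All \<open>b i\<close> lie on the line of the trivial component, so they can be
  rescaled to one fixed vector. Without rescaling the scalars would differ by the factors
  between the \<open>b i\<close>.\<close>

lemma axial_decomposition_algebra_conj_isotypic:
  assumes mf: "multiplicity_free H" and g: "\<forall>i\<in>I. g i \<in> carrier Aut"
    and \<alpha>: "\<forall>i\<in>I. \<alpha> i \<in> conj_isotypic H (g i) (trivial_char GH) \<and> \<alpha> i \<noteq> 0"
  shows "\<forall>i\<in>I. axis \<Phi> (trivial_char GH) (conj_isotypic H (g i)) (\<alpha> i)"
    and "\<exists>c. (\<forall>i\<in>I. c i \<noteq> 0) \<and> axial_decomposition_algebra \<Phi> (trivial_char GH) I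
           (\<lambda>i. conj_isotypic H (g i)) (\<lambda>i. c i *s \<alpha> i)"
    and "\<forall>i\<in>I. \<alpha> i = g i a \<Longrightarrow>
         axial_decomposition_algebra \<Phi> (trivial_char GH) I (\<lambda>i. conj_isotypic H (g i)) \<alpha>"
proof -
  let ?e = "trivial_char GH"
  define b where "b i = (inv\<^bsub>Aut\<^esub> (g i)) (\<alpha> i)" for i
  have gA: "g i \<in> carrier Aut" if "i \<in> I" for i using g that by blast
  have gb: "\<alpha> i = g i (b i)" and b: "b i \<in> isotypic H ?e" "b i \<noteq> 0" if i: "i \<in> I" for i
  proof -
    note gi = gA[OF i]
    show gb: "\<alpha> i = g i (b i)" by (simp add: b_def inv_Aut(2)[OF gi])
    have "\<alpha> i \<in> g i ` isotypic H ?e"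
      using \<alpha> i unfolding conj_isotypic_eq[OF gi trivial_char_Irr, symmetric] by blast
    then show "b i \<in> isotypic H ?e" by (auto simp: b_def inv_Aut(3)[OF gi])
    show "b i \<noteq> 0" using \<alpha> i gb lin_zero[OF Aut_memD(1)[OF gi]] by auto
  qed
  show "\<forall>i\<in>I. axis \<Phi> ?e (conj_isotypic H (g i)) (\<alpha> i)"
    using axis_conj_isotypic[OF mf gA b] gb by simp
  show "\<exists>c. (\<forall>i\<in>I. c i \<noteq> 0) \<and> axial_decomposition_algebra \<Phi> ?e I
           (\<lambda>i. conj_isotypic H (g i)) (\<lambda>i. c i *s \<alpha> i)"
  proof -
    \<comment> \<open>Any of the \<open>b i\<close> can serve as the common vector; the choice is vacuous if \<open>I\<close> is empty.\<close>
    define a where "a = b (SOME i. i \<in> I)"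
    have a: "a \<in> isotypic H ?e \<and> a \<noteq> 0" if "I \<noteq> {}"
      using b someI_ex[of "\<lambda>i. i \<in> I"] that by (auto simp: a_def)
    have "\<exists>c. c \<noteq> 0 \<and> c *s b i = a" if i: "i \<in> I" for i
    proof -
      have a': "a \<in> isotypic H ?e" "a \<noteq> 0" using a i by auto
      obtain c where "a = c *s b i" using isotypic_trivial_proportional[OF mf b[OF i] a'(1)] .
      then show ?thesis using a'(2) by (intro exI[of _ c]) auto
    qed
    then obtain c where c: "\<And>i. i \<in> I \<Longrightarrow> c i \<noteq> 0" "\<And>i. i \<in> I \<Longrightarrow> c i *s b i = a" by metis
    have "c i *s \<alpha> i = g i a" if i: "i \<in> I" for i
      by (simp add: gb[OF i] c(2)[OF i, symmetric] lin_scale[OF Aut_memD(1)[OF gA[OF i]]])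
    then show ?thesis
      using c(1) axial_decomposition_algebra_orbit[OF mf g a] by (intro exI[of _ c]) auto
  qed
  assume \<alpha>a: "\<forall>i\<in>I. \<alpha> i = g i a"
  have "a \<in> isotypic H ?e \<and> a \<noteq> 0" if "I \<noteq> {}"
  proof -
    from that obtain i where i: "i \<in> I" by blast
    have "a = b i" using \<alpha>a i by (simp add: b_def inv_Aut(3)[OF gA[OF i]])
    then show ?thesis using b[OF i] by simp
  qed
  then show "axial_decomposition_algebra \<Phi> ?e I (\<lambda>i. conj_isotypic H (g i)) \<alpha>"
    by (intro axial_decomposition_algebra_orbit[OF mf g _ \<alpha>a])
qed

end

theorem theorem7p2:
  fixes scale :: "complex \<Rightarrow> 'a::ab_group_add \<Rightarrow> 'a"
    and mul :: "'a \<Rightarrow> 'a \<Rightarrow> 'a"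
    and H :: "('a \<Rightarrow> 'a) set"
    and I :: "'i set"
    and g :: "'i \<Rightarrow> 'a \<Rightarrow> 'a"
  defines "G \<equiv> fd_algebra.Aut scale mul"
    and "\<Phi> \<equiv> rep_fusion_law (fd_algebra.Aut scale mul\<lparr>carrier := H\<rparr>)"
    and "e \<equiv> trivial_char (fd_algebra.Aut scale mul\<lparr>carrier := H\<rparr>)"
    and "D \<equiv> fd_algebra.isotypic scale H"
    and "\<Omega> \<equiv> (\<lambda>i. fd_algebra.conj_isotypic scale mul H (g i))"
  assumes alg: "fd_algebra scale mul"
    and H: "subgroup H G" "finite H"
    and g: "\<forall>i\<in>I. g i \<in> carrier G"
  shows
    "fd_algebra.fusion_decomposition scale mul \<Phi> D
     \<and>
     (fd_algebra.multiplicity_free scale H \<longrightarrow>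
        (\<forall>a\<in>D e. a \<noteq> 0 \<longrightarrow> fd_algebra.axis scale mul \<Phi> e D a))
     \<and>
     fd_algebra.decomposition_algebra scale mul \<Phi> I \<Omega>
     \<and>
     (fd_algebra.multiplicity_free scale H \<longrightarrow>
        (\<forall>\<alpha>. (\<forall>i\<in>I. \<alpha> i \<in> \<Omega> i e \<and> \<alpha> i \<noteq> 0) \<longrightarrow>
           (\<forall>i\<in>I. fd_algebra.axis scale mul \<Phi> e (\<Omega> i) (\<alpha> i)) \<and>
           (\<exists>c. (\<forall>i\<in>I. c i \<noteq> 0) \<and>
                fd_algebra.axial_decomposition_algebra scale mul \<Phi> e I \<Omega>
                  (\<lambda>i. scale (c i) (\<alpha> i))) \<and>
           ((\<exists>a. \<forall>i\<in>I. \<alpha> i = g i a) \<longrightarrow>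
                fd_algebra.axial_decomposition_algebra scale mul \<Phi> e I \<Omega> \<alpha>)))"
proof -
  interpret finite_automorphism_group scale mul H
    using alg H unfolding G_def
    by (intro finite_automorphism_group.intro finite_automorphism_group_axioms.intro)
  have gA: "\<forall>i\<in>I. g i \<in> carrier Aut" using g by (simp only: G_def)
  show ?thesis
    unfolding \<Phi>_def e_def D_def \<Omega>_def
  proof (intro conjI impI ballI allI; (elim exE)?)
    fix a assume "multiplicity_free H" "a \<in> isotypic H (trivial_char GH)" "a \<noteq> 0"
    then show "axis (rep_fusion_law GH) (trivial_char GH) (isotypic H) a" by (rule axis_isotypic)
  next
    fix \<alpha> i
    assume mf: "multiplicity_free H"
      and \<alpha>: "\<forall>i\<in>I. \<alpha> i \<in> conj_isotypic H (g i) (trivial_char GH) \<and> \<alpha> i \<noteq> 0" and i: "i \<in> I"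
    from axial_decomposition_algebra_conj_isotypic(1)[OF mf gA \<alpha>] i
    show "axis (rep_fusion_law GH) (trivial_char GH) (conj_isotypic H (g i)) (\<alpha> i)" by blast
  next
    fix \<alpha>
    assume mf: "multiplicity_free H"
      and \<alpha>: "\<forall>i\<in>I. \<alpha> i \<in> conj_isotypic H (g i) (trivial_char GH) \<and> \<alpha> i \<noteq> 0"
    show "\<exists>c. (\<forall>i\<in>I. c i \<noteq> 0) \<and> axial_decomposition_algebra (rep_fusion_law GH) (trivial_char GH) I
        (\<lambda>i. conj_isotypic H (g i)) (\<lambda>i. scale (c i) (\<alpha> i))"
      by (rule axial_decomposition_algebra_conj_isotypic(2)[OF mf gA \<alpha>])
    fix a assume "\<forall>i\<in>I. \<alpha> i = g i a"
    then show "axial_decomposition_algebra (rep_fusion_law GH) (trivial_char GH) I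
        (\<lambda>i. conj_isotypic H (g i)) \<alpha>"
      by (rule axial_decomposition_algebra_conj_isotypic(3)[OF mf gA \<alpha>])
  qed (rule fusion_decomposition_isotypic decomposition_algebra_conj_isotypic[OF gA])+
qed

end
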